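(* Let $W=(W(t))_{t\ge 0}$ be a standard Brownian motion in $\mathbb{R}^3$ started at the origin. Then almost surely the trace $W[0,\infty)=\{W(t):t\ge 0\}$ contains an arithmetic progression of length $5$; that is, almost surely there exist $a,v\in\mathbb{R}^3$ with $v\ne 0$ such that $a+jv\in W[0,\infty)$ for all $j\in\{0,1,2,3,4\}$.
   Context: An arithmetic progression of length $m$ in $\mathbb{R}^3$ is a sequence of points $a,a+v,\dotsc,a+(m-1)v$ with $a,v\in\mathbb{R}^3$ and $v\neq 0$. The points of the progression may be visited by the Brownian motion in any order. *)

theory Defs
  imports "HOL-Probability.Probability"
begin

(* The density of N(0, (t - s) I) is the product of the one-dimensional densities; the second
   parameter of normal_density is the standard deviation.  Only W t for t >= 0 is constrained. *)
locale standard_brownian_motion = prob_space M for M :: "'w measure" +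
  fixes W :: "real \<Rightarrow> 'w \<Rightarrow> real ^ 'n"
  assumes random_variable_W: "\<And>t. 0 \<le> t \<Longrightarrow> random_variable borel (W t)"
    and start_origin: "AE \<omega> in M. W 0 \<omega> = 0"
    and indep_increments:
      "\<And>(t :: nat \<Rightarrow> real) n. 0 \<le> t 0 \<Longrightarrow> (\<And>i. i < n \<Longrightarrow> t i \<le> t (Suc i)) \<Longrightarrow>
         indep_vars (\<lambda>_. borel) (\<lambda>i \<omega>. W (t (Suc i)) \<omega> - W (t i) \<omega>) {..<n}"
    and normal_increments:
      "\<And>s t. 0 \<le> s \<Longrightarrow> s < t \<Longrightarrow>
         distributed M lborel (\<lambda>\<omega>. W t \<omega> - W s \<omega>)
           (\<lambda>x. ennreal (\<Prod>k\<in>UNIV. normal_density 0 (sqrt (t - s)) (x $ k)))"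
    and continuous_paths: "AE \<omega> in M. continuous_on {0..} (\<lambda>t. W t \<omega>)"

definition path_trace :: "(real \<Rightarrow> 'w \<Rightarrow> real ^ 'n) \<Rightarrow> 'w \<Rightarrow> (real ^ 'n) set" where
  "path_trace W \<omega> = (\<lambda>t. W t \<omega>) ` {0..}"

definition contains_arith_prog :: "nat \<Rightarrow> (real ^ 'n) set \<Rightarrow> bool" where
  "contains_arith_prog m S \<longleftrightarrow>
     (\<exists>a v. v \<noteq> 0 \<and> (\<forall>j<m. a + real j *\<^sub>R v \<in> S))"

end

theory Submission
  imports Defs
begin

text \<open>
  Second moment method on a time grid. Take grid times \<open>t i\<close> of mesh \<open>1/m\<close>, one in each of five
  separated unit intervals, and consider the event that the four successive increments agree up to
  \<open>m powr (-1/2)\<close> and are bounded away from 0. It has probability of order \<open>m powr (-9/2)\<close>, and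
  there are \<open>m ^ 5\<close> choices of times. If the event occurs at both \<open>t\<close> and \<open>s\<close>, then the five vectors
  \<open>W (s i) - W (t i)\<close> nearly form a progression, so any three of them are determined by the other two.
  With \<open>d i = max 1 (m * \<bar>t i - s i\<bar>)\<close> this costs an extra factor \<open>\<Prod> d i powr (-3/2)\<close> over those
  three indices, hence, by a geometric mean, \<open>\<Prod> d i powr (-9/10)\<close> over all five. As the exponent
  exceeds \<open>-1\<close>, the second moment is comparable to the square of the mean, uniformly in \<open>m\<close>.
  On \<open>N\<close> successive independent time blocks, Chebyshev's inequality bounds the failure probability
  by \<open>C/N\<close>. As \<open>m\<close> and then \<open>N\<close> tend to infinity, compactness and continuity of the path turn
  approximate progressions into a true one.
\<close>

section \<open>Conditioning on independent families of random variables\<close>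

text \<open>The joint law of independent variables is the product of their laws, so Tonelli applies.
  The inner measure is written with a second sample point \<open>\<omega>'\<close> of
  \<open>M\<close>, so that later estimates concern events of \<open>M\<close> and not image
  measures.\<close>

lemma (in prob_space) emeasure_indep_var_Fubini:
  assumes ind: "indep_var S X T Y"
    and R [measurable]: "Measurable.pred (S \<Otimes>\<^sub>M T) (\<lambda>p. R (fst p) (snd p))"
  shows "emeasure M {\<omega> \<in> space M. R (X \<omega>) (Y \<omega>)} =
    (\<integral>\<^sup>+\<omega>. emeasure M {\<omega>' \<in> space M. R (X \<omega>) (Y \<omega>')} \<partial>M)"
proof -
  have X [measurable]: "X \<in> measurable M S" and Y [measurable]: "Y \<in> measurable M T"
    using ind by (auto dest: indep_var_rv1 indep_var_rv2)
  interpret DX: prob_space "distr M S X" by (rule prob_space_distr) fact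
  interpret DY: prob_space "distr M T Y" by (rule prob_space_distr) fact
  define E where "E = {p \<in> space (S \<Otimes>\<^sub>M T). R (fst p) (snd p)}"
  have E [measurable]: "E \<in> sets (S \<Otimes>\<^sub>M T)" unfolding E_def by measurable
  have XS: "X \<omega> \<in> space S" "Y \<omega> \<in> space T" if "\<omega> \<in> space M" for \<omega>
    using that by (auto intro: measurable_space[OF X] measurable_space[OF Y])
  have "emeasure M {\<omega> \<in> space M. R (X \<omega>) (Y \<omega>)} =
      emeasure (distr M (S \<Otimes>\<^sub>M T) (\<lambda>\<omega>. (X \<omega>, Y \<omega>))) E"
    by (subst emeasure_distr) (auto simp: E_def space_pair_measure XS intro!: arg_cong[where f="emeasure M"])
  also have "\<dots> = emeasure (distr M S X \<Otimes>\<^sub>M distr M T Y) E"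
    using ind by (simp add: indep_var_distribution_eq)
  also have "\<dots> = (\<integral>\<^sup>+x. emeasure (distr M T Y) (Pair x -` E) \<partial>distr M S X)"
    by (rule DY.emeasure_pair_measure_alt) (simp cong: sets_pair_measure_cong)
  also have "\<dots> = (\<integral>\<^sup>+\<omega>. emeasure (distr M T Y) (Pair (X \<omega>) -` E) \<partial>M)"
    by (rule nn_integral_distr) (use DY.measurable_emeasure_Pair[of E S] E in \<open>simp_all cong: measurable_cong_sets sets_pair_measure_cong\<close>)
  also have "\<dots> = (\<integral>\<^sup>+\<omega>. emeasure M {\<omega>' \<in> space M. R (X \<omega>) (Y \<omega>')} \<partial>M)"
  proof (rule nn_integral_cong)
    fix \<omega> assume "\<omega> \<in> space M"
    then have sec: "Pair (X \<omega>) -` E = {y \<in> space T. R (X \<omega>) y}"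
      by (auto simp: E_def space_pair_measure XS)
    then have "{y \<in> space T. R (X \<omega>) y} \<in> sets T"
      using sets_Pair1[OF E, of "X \<omega>"] by simp
    then show "emeasure (distr M T Y) (Pair (X \<omega>) -` E) = emeasure M {\<omega>' \<in> space M. R (X \<omega>) (Y \<omega>')}"
      unfolding sec by (subst emeasure_distr) (auto simp: XS intro!: arg_cong[where f="emeasure M"])
  qed
  finally show ?thesis .
qed

text \<open>In the Fubini formula for the relation \<open>Q x \<and> R x y\<close> the inner
  probability is at most \<open>c\<close> where \<open>Q\<close> holds and vanishes
  elsewhere.\<close>

lemma (in prob_space) prob_indep_var_le:
  assumes ind: "indep_var S X T Y"
    and R: "Measurable.pred (S \<Otimes>\<^sub>M T) (\<lambda>p. R (fst p) (snd p))"
    and Q [measurable]: "Measurable.pred S Q"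
    and le: "\<And>x. x \<in> space S \<Longrightarrow> Q x \<Longrightarrow> prob {\<omega> \<in> space M. R x (Y \<omega>)} \<le> c" and c: "0 \<le> c"
  shows "prob {\<omega> \<in> space M. Q (X \<omega>) \<and> R (X \<omega>) (Y \<omega>)} \<le> prob {\<omega> \<in> space M. Q (X \<omega>)} * c"
proof -
  note R [measurable]
  have X [measurable]: "X \<in> measurable M S"
    using ind by (auto dest: indep_var_rv1)
  have "emeasure M {\<omega> \<in> space M. Q (X \<omega>) \<and> R (X \<omega>) (Y \<omega>)} =
      (\<integral>\<^sup>+\<omega>. emeasure M {\<omega>' \<in> space M. Q (X \<omega>) \<and> R (X \<omega>) (Y \<omega>')} \<partial>M)"
    by (rule emeasure_indep_var_Fubini[OF ind]) measurable
  also have "\<dots> \<le> (\<integral>\<^sup>+\<omega>. ennreal c * indicator {\<omega> \<in> space M. Q (X \<omega>)} \<omega> \<partial>M)"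
  proof (rule nn_integral_mono)
    fix \<omega> assume w: "\<omega> \<in> space M"
    then have "X \<omega> \<in> space S" by (rule measurable_space[OF X])
    with w le[of "X \<omega>"] show "emeasure M {\<omega>' \<in> space M. Q (X \<omega>) \<and> R (X \<omega>) (Y \<omega>')}
        \<le> ennreal c * indicator {\<omega> \<in> space M. Q (X \<omega>)} \<omega>"
      by (auto simp: emeasure_eq_measure indicator_def c)
  qed
  also have "\<dots> = ennreal c * emeasure M {\<omega> \<in> space M. Q (X \<omega>)}"
    by (rule nn_integral_cmult_indicator) measurable
  finally show ?thesis
    using c by (simp add: emeasure_eq_measure mult.commute flip: ennreal_mult')
qed

lemma (in prob_space) prob_indep_var_ge:
  assumes ind: "indep_var S X T Y"
    and R: "Measurable.pred (S \<Otimes>\<^sub>M T) (\<lambda>p. R (fst p) (snd p))"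
    and Q [measurable]: "Measurable.pred S Q"
    and ge: "\<And>x. x \<in> space S \<Longrightarrow> Q x \<Longrightarrow> c \<le> prob {\<omega> \<in> space M. R x (Y \<omega>)}" and c: "0 \<le> c"
  shows "prob {\<omega> \<in> space M. Q (X \<omega>)} * c \<le> prob {\<omega> \<in> space M. Q (X \<omega>) \<and> R (X \<omega>) (Y \<omega>)}"
proof -
  note R [measurable]
  have X [measurable]: "X \<in> measurable M S"
    using ind by (auto dest: indep_var_rv1)
  have "ennreal c * emeasure M {\<omega> \<in> space M. Q (X \<omega>)} =
      (\<integral>\<^sup>+\<omega>. ennreal c * indicator {\<omega> \<in> space M. Q (X \<omega>)} \<omega> \<partial>M)"
    by (rule nn_integral_cmult_indicator[symmetric]) measurable
  also have "\<dots> \<le> (\<integral>\<^sup>+\<omega>. emeasure M {\<omega>' \<in> space M. Q (X \<omega>) \<and> R (X \<omega>) (Y \<omega>')} \<partial>M)"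
  proof (rule nn_integral_mono)
    fix \<omega> assume w: "\<omega> \<in> space M"
    then have "X \<omega> \<in> space S" by (rule measurable_space[OF X])
    with w ge[of "X \<omega>"] show "ennreal c * indicator {\<omega> \<in> space M. Q (X \<omega>)} \<omega> \<le>
        emeasure M {\<omega>' \<in> space M. Q (X \<omega>) \<and> R (X \<omega>) (Y \<omega>')}"
      by (auto simp: emeasure_eq_measure indicator_def c)
  qed
  also have "\<dots> = emeasure M {\<omega> \<in> space M. Q (X \<omega>) \<and> R (X \<omega>) (Y \<omega>)}"
    by (rule emeasure_indep_var_Fubini[OF ind, symmetric]) measurable
  finally show ?thesis
    using c by (simp add: emeasure_eq_measure mult.commute flip: ennreal_mult')
qed

lemma (in prob_space) prob_indep_vars_all:
  assumes "indep_vars (\<lambda>_. borel) Y S" "finite S" "\<And>i. i \<in> S \<Longrightarrow> A i \<in> sets borel"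
  shows "prob {\<omega> \<in> space M. \<forall>i\<in>S. Y i \<omega> \<in> A i} = (\<Prod>i\<in>S. prob {\<omega> \<in> space M. Y i \<omega> \<in> A i})"
proof (cases "S = {}")
  case True
  then show ?thesis by (simp add: prob_space)
next
  case False
  have "{\<omega> \<in> space M. \<forall>i\<in>S. Y i \<omega> \<in> A i} = (\<Inter>i\<in>S. Y i -` A i \<inter> space M)"
    using False by auto
  then show ?thesis
    using indep_varsD_finite[OF assms(1) False assms(2,3)]
    by (simp add: vimage_def Int_def conj_commute)
qed

text \<open>Given the coordinates in \<open>B\<close>, the centres \<open>g i y\<close> are
  constants while the coordinates in \<open>S\<close> stay independent, so the ball probabilities
  multiply. The upper bound serves the second moment, the lower bound the mean.\<close>

lemma (in prob_space)
  fixes Y :: "'i \<Rightarrow> 'a \<Rightarrow> 'b::euclidean_space" and g :: "'i \<Rightarrow> ('i \<Rightarrow> 'b) \<Rightarrow> 'b"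
  assumes ind: "indep_vars (\<lambda>_. borel) Y I" and "B \<subseteq> I" "S \<subseteq> I" "B \<inter> S = {}" "finite S"
    and Q [measurable]: "Measurable.pred (PiM B (\<lambda>_. borel)) Q"
    and g [measurable]: "\<And>i. i \<in> S \<Longrightarrow> g i \<in> measurable (PiM B (\<lambda>_. borel)) borel"
    and c: "\<And>i. i \<in> S \<Longrightarrow> 0 \<le> c i"
  shows prob_indep_vars_cball_le:
    "(\<And>i y. i \<in> S \<Longrightarrow> Q y \<Longrightarrow> prob {\<omega> \<in> space M. Y i \<omega> \<in> cball (g i y) (r i)} \<le> c i) \<Longrightarrow>
     prob {\<omega> \<in> space M. Q (\<lambda>i\<in>B. Y i \<omega>) \<and> (\<forall>i\<in>S. Y i \<omega> \<in> cball (g i (\<lambda>i\<in>B. Y i \<omega>)) (r i))}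
       \<le> prob {\<omega> \<in> space M. Q (\<lambda>i\<in>B. Y i \<omega>)} * (\<Prod>i\<in>S. c i)"
   and prob_indep_vars_cball_ge:
    "(\<And>i y. i \<in> S \<Longrightarrow> Q y \<Longrightarrow> c i \<le> prob {\<omega> \<in> space M. Y i \<omega> \<in> cball (g i y) (r i)}) \<Longrightarrow>
     prob {\<omega> \<in> space M. Q (\<lambda>i\<in>B. Y i \<omega>)} * (\<Prod>i\<in>S. c i) \<le>
     prob {\<omega> \<in> space M. Q (\<lambda>i\<in>B. Y i \<omega>) \<and> (\<forall>i\<in>S. Y i \<omega> \<in> cball (g i (\<lambda>i\<in>B. Y i \<omega>)) (r i))}"
proof -
  define R where "R = (\<lambda>y z. \<forall>i\<in>S. z i \<in> cball (g i y) (r i))"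
  have R: "Measurable.pred (PiM B (\<lambda>_. borel) \<Otimes>\<^sub>M PiM S (\<lambda>_. borel)) (\<lambda>p. R (fst p) (snd p))"
    unfolding R_def mem_cball
    by (rule pred_intros_finite(3)[OF \<open>finite S\<close>]) measurable
  have iv: "indep_var (PiM B (\<lambda>_. borel)) (\<lambda>\<omega>. restrict (\<lambda>i. Y i \<omega>) B)
       (PiM S (\<lambda>_. borel)) (\<lambda>\<omega>. restrict (\<lambda>i. Y i \<omega>) S)"
    using assms by (intro indep_var_restrict[OF ind]) auto
  have eq: "prob {\<omega> \<in> space M. R y (\<lambda>i\<in>S. Y i \<omega>)} =
      (\<Prod>i\<in>S. prob {\<omega> \<in> space M. Y i \<omega> \<in> cball (g i y) (r i)})" for y
    using prob_indep_vars_all[OF indep_vars_subset[OF ind \<open>S \<subseteq> I\<close>] \<open>finite S\<close>, of "\<lambda>i. cball (g i y) (r i)"]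
    by (simp add: R_def)
  have ev: "{\<omega> \<in> space M. Q (\<lambda>i\<in>B. Y i \<omega>) \<and> (\<forall>i\<in>S. Y i \<omega> \<in> cball (g i (\<lambda>i\<in>B. Y i \<omega>)) (r i))} =
    {\<omega> \<in> space M. Q (\<lambda>i\<in>B. Y i \<omega>) \<and> R (\<lambda>i\<in>B. Y i \<omega>) (\<lambda>i\<in>S. Y i \<omega>)}"
    by (simp add: R_def)
  show "prob {\<omega> \<in> space M. Q (\<lambda>i\<in>B. Y i \<omega>) \<and> (\<forall>i\<in>S. Y i \<omega> \<in> cball (g i (\<lambda>i\<in>B. Y i \<omega>)) (r i))}
       \<le> prob {\<omega> \<in> space M. Q (\<lambda>i\<in>B. Y i \<omega>)} * (\<Prod>i\<in>S. c i)"
    if le: "\<And>i y. i \<in> S \<Longrightarrow> Q y \<Longrightarrow> prob {\<omega> \<in> space M. Y i \<omega> \<in> cball (g i y) (r i)} \<le> c i"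
    unfolding ev
    by (rule prob_indep_var_le[OF iv R Q]) (simp_all only: eq, auto simp del: mem_cball intro!: prod_mono prod_nonneg le c)
  show "prob {\<omega> \<in> space M. Q (\<lambda>i\<in>B. Y i \<omega>)} * (\<Prod>i\<in>S. c i) \<le>
     prob {\<omega> \<in> space M. Q (\<lambda>i\<in>B. Y i \<omega>) \<and> (\<forall>i\<in>S. Y i \<omega> \<in> cball (g i (\<lambda>i\<in>B. Y i \<omega>)) (r i))}"
    if ge: "\<And>i y. i \<in> S \<Longrightarrow> Q y \<Longrightarrow> c i \<le> prob {\<omega> \<in> space M. Y i \<omega> \<in> cball (g i y) (r i)}"
    unfolding ev
    by (rule prob_indep_var_ge[OF iv R Q]) (simp_all only: eq, auto simp del: mem_cball intro!: prod_mono prod_nonneg ge c)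
qed

section \<open>Small-ball estimates for Gaussian increments\<close>

context standard_brownian_motion
begin

text \<open>Ball volume times the supremum of the density, with the factors
  \<open>1 / sqrt (2 * pi)\<close> bounded by 1. Uniformity in \<open>z\<close> is what allows
  random centres later.\<close>

lemma prob_increment_cball_le:
  assumes "0 \<le> s" "s < t" "0 \<le> r"
  shows "prob {\<omega> \<in> space M. W t \<omega> - W s \<omega> \<in> cball z r}
    \<le> unit_ball_vol (real CARD('n)) * (r / sqrt (t - s)) ^ CARD('n)"
proof -
  let ?d = "\<lambda>x::real^'n. \<Prod>k\<in>UNIV. normal_density 0 (sqrt (t - s)) (x $ k)"
  have d: "?d x \<le> (1 / sqrt (t - s)) ^ CARD('n)" for x
  proof -
    have "normal_density 0 (sqrt (t - s)) (x $ k) \<le> 1 / sqrt (t - s)" for k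
    proof -
      have "1 * (t - s) \<le> 2 * pi * (t - s)"
        using assms pi_gt3 by (intro mult_right_mono) auto
      then have "1 / sqrt (2 * pi * (sqrt (t - s))\<^sup>2) \<le> 1 / sqrt (t - s)"
        using assms by (intro divide_left_mono) auto
      moreover have "exp (- (x $ k - 0)\<^sup>2 / (2 * (sqrt (t - s))\<^sup>2)) \<le> 1"
        using assms by simp
      ultimately have "normal_density 0 (sqrt (t - s)) (x $ k) \<le> 1 / sqrt (t - s) * 1"
        unfolding normal_density_def using assms by (intro mult_mono) auto
      then show ?thesis by simp
    qed
    then have "?d x \<le> (\<Prod>k\<in>(UNIV::'n set). 1 / sqrt (t - s))"
      by (intro prod_mono) auto
    then show ?thesis by simp
  qed
  have "emeasure M ((\<lambda>\<omega>. W t \<omega> - W s \<omega>) -` cball z r \<inter> space M) =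
      (\<integral>\<^sup>+x. ennreal (?d x) * indicator (cball z r) x \<partial>lborel)"
    by (rule distributed_emeasure[OF normal_increments[OF assms(1,2)]]) simp
  also have "\<dots> \<le> (\<integral>\<^sup>+x. ennreal ((1 / sqrt (t - s)) ^ CARD('n)) * indicator (cball z r) x \<partial>lborel)"
    by (intro nn_integral_mono mult_right_mono ennreal_leI d) auto
  also have "\<dots> = ennreal ((1 / sqrt (t - s)) ^ CARD('n)) * emeasure lborel (cball z r)"
    by (rule nn_integral_cmult_indicator) simp
  also have "\<dots> = ennreal (unit_ball_vol (real CARD('n)) * (r / sqrt (t - s)) ^ CARD('n))"
    using assms by (simp add: emeasure_cball flip: ennreal_mult) (simp add: power_divide)
  also have "(\<lambda>\<omega>. W t \<omega> - W s \<omega>) -` cball z r \<inter> space M = {\<omega> \<in> space M. W t \<omega> - W s \<omega> \<in> cball z r}"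
    by auto
  finally show ?thesis
    using assms by (simp add: emeasure_eq_measure)
qed

text \<open>Ball volume times the infimum of the density on the ball. There every coordinate is at
  most \<open>R\<close> in absolute value; \<open>1 \<le> t - s\<close> controls the exponential and
  \<open>t - s \<le> 3\<close> the normalising factor.\<close>

lemma prob_increment_cball_ge:
  assumes "0 \<le> s" "1 \<le> t - s" "t - s \<le> 3" "0 \<le> r" "norm z + r \<le> R"
  shows "unit_ball_vol (real CARD('n)) * (exp (- (R\<^sup>2 / 2)) / sqrt (6 * pi) * r) ^ CARD('n)
    \<le> prob {\<omega> \<in> space M. W t \<omega> - W s \<omega> \<in> cball z r}"
proof -
  let ?d = "\<lambda>x::real^'n. \<Prod>k\<in>UNIV. normal_density 0 (sqrt (t - s)) (x $ k)"
  let ?c = "exp (- (R\<^sup>2 / 2)) / sqrt (6 * pi)"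
  have d: "?c ^ CARD('n) \<le> ?d x" if "x \<in> cball z r" for x
  proof -
    have "?c \<le> normal_density 0 (sqrt (t - s)) (x $ k)" for k
    proof -
      have "norm x \<le> R"
        using that assms(5) norm_triangle_ineq2[of x z] by (auto simp: dist_norm norm_minus_commute)
      then have "\<bar>x $ k\<bar> \<le> R" using component_le_norm_cart[of x k] by linarith
      then have "(x $ k)\<^sup>2 \<le> R\<^sup>2" by (metis abs_ge_zero power2_abs power_mono)
      moreover have "(x $ k)\<^sup>2 / (2 * (t - s)) \<le> (x $ k)\<^sup>2 / 2"
        using assms by (intro divide_left_mono) auto
      ultimately have "(x $ k)\<^sup>2 / (2 * (t - s)) \<le> R\<^sup>2 / 2" by linarith
      then have e: "exp (- (R\<^sup>2 / 2)) \<le> exp (- (x $ k)\<^sup>2 / (2 * (t - s)))" by simp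
      have "2 * pi * (t - s) \<le> 2 * pi * 3"
        using assms by (intro mult_left_mono) auto
      then have "1 / sqrt (6 * pi) \<le> 1 / sqrt (2 * pi * (t - s))"
        using assms by (intro divide_left_mono) auto
      with e have "1 / sqrt (6 * pi) * exp (- (R\<^sup>2 / 2)) \<le>
          1 / sqrt (2 * pi * (t - s)) * exp (- (x $ k)\<^sup>2 / (2 * (t - s)))"
        using assms by (intro mult_mono) auto
      then show ?thesis using assms by (simp add: normal_density_def)
    qed
    then have "(\<Prod>k\<in>(UNIV::'n set). ?c) \<le> ?d x"
      by (intro prod_mono) auto
    then show ?thesis by simp
  qed
  have "ennreal (unit_ball_vol (real CARD('n)) * (?c * r) ^ CARD('n)) =
      ennreal (?c ^ CARD('n)) * emeasure lborel (cball z r)"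
    using assms by (simp add: emeasure_cball flip: ennreal_mult) (simp add: power_mult_distrib power_divide)
  also have "\<dots> = (\<integral>\<^sup>+x. ennreal (?c ^ CARD('n)) * indicator (cball z r) x \<partial>lborel)"
    by (rule nn_integral_cmult_indicator[symmetric]) simp
  also have "\<dots> \<le> (\<integral>\<^sup>+x. ennreal (?d x) * indicator (cball z r) x \<partial>lborel)"
    by (intro nn_integral_mono) (simp add: indicator_def ennreal_leI d del: mem_cball)
  also have "\<dots> = emeasure M ((\<lambda>\<omega>. W t \<omega> - W s \<omega>) -` cball z r \<inter> space M)"
    using assms by (intro distributed_emeasure[OF normal_increments, symmetric]) auto
  also have "(\<lambda>\<omega>. W t \<omega> - W s \<omega>) -` cball z r \<inter> space M = {\<omega> \<in> space M. W t \<omega> - W s \<omega> \<in> cball z r}"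
    by auto
  finally show ?thesis
    by (simp add: emeasure_eq_measure)
qed

end

section \<open>Near progressions: rigidity and probability bounds\<close>

text \<open>Interpolation from the indices \<open>p\<close> and \<open>q\<close> is exact on true
  progressions, so only the accumulated deviation from one contributes. Applied to displacements
  between two near progressions, this shows that two of them determine the others.\<close>

lemma norm_nearly_affine_le:
  fixes x :: "nat \<Rightarrow> 'a::real_normed_vector"
  assumes d: "\<And>i. i < n \<Longrightarrow> norm ((x (Suc i) - x i) - (x 1 - x 0)) \<le> r"
    and pq: "p \<le> n" "q \<le> n" "p \<noteq> q" and "i \<le> n" and "0 \<le> r"
  shows "norm (x i - (x p + ((real i - real p) / (real q - real p)) *\<^sub>R (x q - x p)))
    \<le> 2 * real n * (real n + 1) * r"
proof -
  \<comment> \<open>Deviation from the exact progression that starts at \<open>x 0\<close> with step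
    \<open>x 1 - x 0\<close>; it grows by at most \<open>r\<close> per index.\<close>
  define e where "e = (\<lambda>i. x i - x 0 - real i *\<^sub>R (x 1 - x 0))"
  have e: "norm (e i) \<le> real n * r" if "i \<le> n" for i
  proof -
    have "norm (e i) \<le> real i * r" using that
    proof (induction i)
      case (Suc i)
      have "e (Suc i) = e i + ((x (Suc i) - x i) - (x 1 - x 0))"
        by (simp add: e_def algebra_simps)
      then have "norm (e (Suc i)) \<le> norm (e i) + norm ((x (Suc i) - x i) - (x 1 - x 0))"
        by (metis norm_triangle_ineq)
      with Suc d[of i] show ?case by (simp add: algebra_simps)
    qed (simp add: e_def)
    also have "\<dots> \<le> real n * r" using that \<open>0 \<le> r\<close> by (intro mult_right_mono) auto
    finally show ?thesis .
  qed
  define c where "c = (real i - real p) / (real q - real p)"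
  have "1 \<le> \<bar>real q - real p\<bar>" "\<bar>real i - real p\<bar> \<le> real n" using assms by auto
  then have c: "\<bar>c\<bar> \<le> real n"
    using frac_le[of "real n" "\<bar>real i - real p\<bar>" 1 "\<bar>real q - real p\<bar>"] by (simp add: c_def)
  have c': "c * (real q - real p) = real i - real p" using pq by (simp add: c_def)
  have "x i - (x p + c *\<^sub>R (x q - x p)) = e i - e p - c *\<^sub>R (e q - e p)
      + (real i - real p - c * (real q - real p)) *\<^sub>R (x 1 - x 0)"
    by (simp add: e_def algebra_simps)
  then have "norm (x i - (x p + c *\<^sub>R (x q - x p))) = norm (e i - e p - c *\<^sub>R (e q - e p))"
    using c' by simp
  also have "\<dots> \<le> norm (e i) + norm (e p) + \<bar>c\<bar> * (norm (e q) + norm (e p))"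
  proof -
    have "norm (e i - e p - c *\<^sub>R (e q - e p)) \<le> norm (e i - e p) + norm (c *\<^sub>R (e q - e p))"
      by (rule norm_triangle_ineq4)
    moreover have "norm (e i - e p) \<le> norm (e i) + norm (e p)" by (rule norm_triangle_ineq4)
    moreover have "norm (c *\<^sub>R (e q - e p)) \<le> \<bar>c\<bar> * (norm (e q) + norm (e p))"
      unfolding norm_scaleR by (intro mult_left_mono norm_triangle_ineq4) simp
    ultimately show ?thesis by linarith
  qed
  also have "\<dots> \<le> real n * r + real n * r + real n * (real n * r + real n * r)"
    using assms c by (intro add_mono mult_mono e) auto
  finally show ?thesis by (simp add: c_def algebra_simps)
qed

lemma norm_axis_2: "norm (axis k (2::real)) = 2"
  by (simp add: norm_eq_sqrt_inner inner_axis_axis)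

locale brownian_motion_3d = standard_brownian_motion M W
  for M :: "'w measure" and W :: "real \<Rightarrow> 'w \<Rightarrow> real ^ 3"
begin

text \<open>
  The first increment is confined to a fixed ball away from the origin: this keeps the limiting step
  nonzero and the Gaussian densities bounded below.
\<close>

definition near_prog :: "real \<Rightarrow> (nat \<Rightarrow> real) \<Rightarrow> 'w set" where
  "near_prog r t = {\<omega> \<in> space M. W (t 1) \<omega> - W (t 0) \<omega> \<in> cball (axis 1 2) 1 \<and>
     (\<forall>i\<in>{1,2,3}. W (t (Suc i)) \<omega> - W (t i) \<omega> \<in> cball (W (t 1) \<omega> - W (t 0) \<omega>) r)}"

lemma near_prog_sets:
  assumes "\<And>i. i \<le> 4 \<Longrightarrow> 0 \<le> t i"
  shows "near_prog r t \<in> events"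
proof -
  have [measurable]: "random_variable borel (W (t i))" if "i \<in> {0,1,2,3,4}" for i
    using that assms[of i] by (intro random_variable_W) auto
  have "near_prog r t = {\<omega> \<in> space M. W (t 1) \<omega> - W (t 0) \<omega> \<in> cball (axis 1 2) 1 \<and>
     W (t 2) \<omega> - W (t 1) \<omega> \<in> cball (W (t 1) \<omega> - W (t 0) \<omega>) r \<and>
     W (t 3) \<omega> - W (t 2) \<omega> \<in> cball (W (t 1) \<omega> - W (t 0) \<omega>) r \<and>
     W (t 4) \<omega> - W (t 3) \<omega> \<in> cball (W (t 1) \<omega> - W (t 0) \<omega>) r}"
    by (auto simp: near_prog_def eval_nat_numeral)
  also have "\<dots> \<in> events" unfolding mem_cball by measurable
  finally show ?thesis .
qed

text \<open>The first increment hits its fixed ball with probability bounded below. Given it, each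
  of the other three independent increments hits a ball of radius \<open>r\<close> with probability
  of order \<open>r ^ 3\<close>, whence \<open>r ^ 9\<close>.\<close>

lemma prob_near_prog_ge:
  assumes t0: "0 \<le> t 0" and t: "\<And>i. i < 4 \<Longrightarrow> 1 \<le> t (Suc i) - t i \<and> t (Suc i) - t i \<le> 3"
    and r: "0 \<le> r" "r \<le> 1"
  shows "(unit_ball_vol 3) ^ 4 * (exp (- 8) / sqrt (6 * pi)) ^ 12 * r ^ 9 \<le> prob (near_prog r t)"
proof -
  define Y where "Y = (\<lambda>i \<omega>. W (t (Suc i)) \<omega> - W (t i) \<omega>)"
  define c where "c = exp (- 8) / sqrt (6 * pi)"
  have pos: "0 \<le> t i" if "i < 4" for i
    using that
  proof (induction i)
    case (Suc i)
    then show ?case using t[of i] by simp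
  qed (use t0 in simp)
  have ind: "indep_vars (\<lambda>_. borel) Y {..<4}"
    unfolding Y_def by (rule indep_increments) (use t0 t in force)+
  \<comment> \<open>The radius 4 covers both uses: the first increment has norm at most 2 + 1 = 3,
    and \<open>r \<le> 1\<close> adds at most 1. Then \<open>R = 4\<close> in the density bound
    gives the factor \<open>exp (- 8)\<close>.\<close>
  have ge: "unit_ball_vol 3 * (c * \<rho>) ^ 3 \<le> prob {\<omega> \<in> space M. Y i \<omega> \<in> cball z \<rho>}"
    if "i < 4" "norm z + \<rho> \<le> 4" "0 \<le> \<rho>" for i z \<rho>
    using prob_increment_cball_ge[of "t i" "t (Suc i)" \<rho> z 4] that t[of i] pos[of i]
    by (simp add: Y_def c_def)
  have "unit_ball_vol 3 * (c * 1) ^ 3 * (\<Prod>i\<in>{1,2,3::nat}. unit_ball_vol 3 * (c * r) ^ 3) \<le>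
     prob {\<omega> \<in> space M. (\<lambda>i\<in>{0}. Y i \<omega>) 0 \<in> cball (axis 1 2) 1} *
     (\<Prod>i\<in>{1,2,3::nat}. unit_ball_vol 3 * (c * r) ^ 3)"
    using ge[of 0 "axis 1 2" 1] r by (intro mult_right_mono) (auto simp: norm_axis_2 c_def)
  also have "\<dots> \<le> prob {\<omega> \<in> space M. (\<lambda>i\<in>{0}. Y i \<omega>) 0 \<in> cball (axis 1 2) 1 \<and>
     (\<forall>i\<in>{1,2,3}. Y i \<omega> \<in> cball ((\<lambda>i\<in>{0}. Y i \<omega>) 0) r)}"
  proof (rule prob_indep_vars_cball_ge[OF ind, where Q = "\<lambda>y. y 0 \<in> cball (axis 1 2) 1" and g = "\<lambda>_ y. y 0"])
    fix i :: nat and y :: "nat \<Rightarrow> real^3" assume i: "i \<in> {1,2,3}" and y: "y 0 \<in> cball (axis 1 2) 1"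
    have "norm (y 0) \<le> 3"
      using y norm_triangle_ineq2[of "y 0" "axis 1 2"] by (auto simp: dist_norm norm_minus_commute norm_axis_2)
    with i r show "unit_ball_vol 3 * (c * r) ^ 3 \<le> prob {\<omega> \<in> space M. Y i \<omega> \<in> cball (y 0) r}"
      by (intro ge) auto
  qed (use r in \<open>auto simp: c_def\<close>)
  also have "\<dots> = prob (near_prog r t)"
    by (simp add: near_prog_def Y_def)
  finally have "unit_ball_vol 3 ^ 4 * c ^ 12 * r ^ 9 \<le> prob (near_prog r t)"
    by (simp add: mult_ac eval_nat_numeral)
  then show ?thesis by (simp add: c_def)
qed

text \<open>The two events are functions of disjoint groups of independent increments. In the
  variance this makes different time blocks contribute no positive covariance.\<close>

lemma prob_near_prog_disjoint_le:
  assumes t0: "0 \<le> t 0" and t: "\<And>i. i < 4 \<Longrightarrow> t i \<le> t (Suc i)"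
    and s: "\<And>i. i < 4 \<Longrightarrow> s i \<le> s (Suc i)" and ts: "t 4 \<le> s 0"
  shows "prob (near_prog r t \<inter> near_prog r s) \<le> prob (near_prog r t) * prob (near_prog r s)"
proof -
  \<comment> \<open>Concatenation of the two time sequences: increments 0 to 3 belong to
    \<open>t\<close>, increments 5 to 8 to \<open>s\<close>, and increment 4 bridges the
    gap.\<close>
  define \<tau> where "\<tau> = (\<lambda>j::nat. if j < 5 then t j else s (j - 5))"
  define Y where "Y = (\<lambda>i \<omega>. W (\<tau> (Suc i)) \<omega> - W (\<tau> i) \<omega>)"
  have "\<tau> i \<le> \<tau> (Suc i)" if "i < 9" for i
  proof -
    consider "i < 4" | "i = 4" | "5 \<le> i" by linarith
    then show ?thesis
    proof cases
      case 3
      then have "Suc i - 5 = Suc (i - 5)" by simp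
      with 3 s[of "i - 5"] that show ?thesis by (simp add: \<tau>_def)
    qed (use t[of i] ts in \<open>auto simp: \<tau>_def\<close>)
  qed
  then have ind: "indep_vars (\<lambda>_. borel) Y {..<9}"
    unfolding Y_def by (intro indep_increments) (auto simp: \<tau>_def t0)
  define I where "I = {0,1,2,3::nat}"
  define J where "J = {5,6,7,8::nat}"
  define P where "P = (\<lambda>(j::nat) y. y j \<in> cball (axis 1 2 :: real^3) 1 \<and>
     y (j + 1) \<in> cball (y j) r \<and> y (j + 2) \<in> cball (y j) r \<and> y (j + 3) \<in> cball (y j) r)"
  have iv: "indep_var (PiM I (\<lambda>_. borel)) (\<lambda>\<omega>. restrict (\<lambda>i. Y i \<omega>) I)
       (PiM J (\<lambda>_. borel)) (\<lambda>\<omega>. restrict (\<lambda>i. Y i \<omega>) J)"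
    by (intro indep_var_restrict[OF ind]) (auto simp: I_def J_def)
  have nt: "near_prog r t = {\<omega> \<in> space M. P 0 (\<lambda>i\<in>I. Y i \<omega>)}"
    by (simp add: near_prog_def P_def I_def Y_def \<tau>_def eval_nat_numeral)
  have ns: "near_prog r s = {\<omega> \<in> space M. P 5 (\<lambda>i\<in>J. Y i \<omega>)}"
    by (simp add: near_prog_def P_def J_def Y_def \<tau>_def eval_nat_numeral)
  have [measurable]: "Measurable.pred (PiM I (\<lambda>_. borel)) (P 0)"
    unfolding P_def I_def mem_cball by measurable
  have P5 [measurable]: "Measurable.pred (PiM J (\<lambda>_. borel)) (P 5)"
    unfolding P_def J_def mem_cball by measurable
  have "prob {\<omega> \<in> space M. P 0 (\<lambda>i\<in>I. Y i \<omega>) \<and> P 5 (\<lambda>i\<in>J. Y i \<omega>)} \<le>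
     prob {\<omega> \<in> space M. P 0 (\<lambda>i\<in>I. Y i \<omega>)} * prob {\<omega> \<in> space M. P 5 (\<lambda>i\<in>J. Y i \<omega>)}"
    by (rule prob_indep_var_le[OF iv, where R = "\<lambda>_. P 5"]) (auto intro: measurable_compose[OF measurable_snd P5])
  then show ?thesis
    unfolding nt ns by (simp add: Int_def conj_ac)
qed

text \<open>If both events occur, the displacements \<open>W (s i) - W (t i)\<close> have nearly
  equal successive differences, so those outside \<open>p\<close>, \<open>q\<close> lie near values
  predicted from these two; this yields the product of the \<open>\<beta> i\<close>. Given the
  displacements and the first bridging increment, the event for \<open>t\<close> confines three more
  independent increments, over time gaps of at least 1, to balls of radius \<open>r\<close>.\<close>

lemma prob_near_prog_pair_le:
  assumes b: "0 \<le> b" and r: "0 \<le> r"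
    and t: "\<And>i. i < 5 \<Longrightarrow> b + 2 * real i \<le> t i \<and> t i \<le> b + 2 * real i + 1"
    and s: "\<And>i. i < 5 \<Longrightarrow> b + 2 * real i \<le> s i \<and> s i \<le> b + 2 * real i + 1"
    and \<beta>: "\<And>i z. i < 5 \<Longrightarrow> prob {\<omega> \<in> space M. W (max (t i) (s i)) \<omega> - W (min (t i) (s i)) \<omega> \<in> cball z (80 * r)} \<le> \<beta> i"
    and pq: "p < 5" "q < 5" "p \<noteq> q"
  shows "prob (near_prog r t \<inter> near_prog r s) \<le>
    (\<Prod>i\<in>{..<5} - {p,q}. \<beta> i) * (unit_ball_vol 3 * r ^ 3) ^ 3"
proof -
  \<comment> \<open>The ten times in increasing order: indices \<open>2 * i\<close> and
    \<open>2 * i + 1\<close> carry the earlier and the later of \<open>t i\<close> and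
    \<open>s i\<close>.\<close>
  define \<tau> where "\<tau> = (\<lambda>j::nat. if even j then min (t (j div 2)) (s (j div 2)) else max (t (j div 2)) (s (j div 2)))"
  define Y where "Y = (\<lambda>i \<omega>. W (\<tau> (Suc i)) \<omega> - W (\<tau> i) \<omega>)"
  have step: "\<tau> i \<le> \<tau> (Suc i) \<and> (odd i \<longrightarrow> 1 \<le> \<tau> (Suc i) - \<tau> i)" if "i < 9" for i
  proof (cases "even i")
    case True
    then show ?thesis by (auto simp: \<tau>_def)
  next
    case False
    then obtain j where j: "i = 2 * j + 1" by (elim oddE)
    with that have "j < 4" by simp
    with t[of j] s[of j] t[of "Suc j"] s[of "Suc j"] show ?thesis
      by (auto simp: \<tau>_def j)
  qed
  have pos: "0 \<le> \<tau> i" if "i < 10" for i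
  proof -
    have "i div 2 < 5" using that by auto
    with t[of "i div 2"] s[of "i div 2"] b have "0 \<le> t (i div 2)" "0 \<le> s (i div 2)"
      by (smt (verit) of_nat_0_le_iff)+
    then show ?thesis by (auto simp: \<tau>_def)
  qed
  have ind: "indep_vars (\<lambda>_. borel) Y {..<9}"
    unfolding Y_def by (intro indep_increments pos) (use step in auto)
  \<comment> \<open>\<open>Y (2 * i)\<close> is the increment of \<open>W\<close> between \<open>t i\<close> and \<open>s i\<close> in increasing time order,
    \<open>\<sigma> i\<close> restores its sign, and the odd-indexed \<open>Y\<close> bridge the gaps between the unit intervals.\<close>
  define a where "a = (\<lambda>i. if s i < t i then 1 else (0::real))"
  define \<sigma> where "\<sigma> = (\<lambda>i. 1 - 2 * a i)"
  have a01: "a i = 0 \<or> a i = 1" for i by (simp add: a_def)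
  have \<sigma>1: "\<sigma> i * \<sigma> i = 1" "\<bar>\<sigma> i\<bar> = 1" for i by (simp_all add: \<sigma>_def a_def)
  have \<sigma>_split: "\<sigma> i = 1 - a i - a i" for i by (simp add: \<sigma>_def)
  have Wt: "W (t i) \<omega> = W (\<tau> (2 * i)) \<omega> + a i *\<^sub>R Y (2 * i) \<omega>" for i \<omega>
    by (auto simp: \<tau>_def Y_def a_def min_def max_def)
  have Ws: "W (s i) \<omega> = W (\<tau> (2 * i)) \<omega> + (1 - a i) *\<^sub>R Y (2 * i) \<omega>" for i \<omega>
    by (auto simp: \<tau>_def Y_def a_def min_def max_def)
  have W\<tau>: "W (\<tau> (2 * Suc i)) \<omega> = W (\<tau> (2 * i)) \<omega> + Y (2 * i) \<omega> + Y (2 * i + 1) \<omega>" for i \<omega>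
    by (simp add: Y_def)
  \<comment> \<open>Predicted value of \<open>Y j\<close> for even \<open>j\<close>: interpolate the
    signed displacements at \<open>p\<close> and \<open>q\<close>, then multiply by
    \<open>\<sigma> i\<close> to return to increasing time order.\<close>
  define L where "L = (\<lambda>j y. let i = j div 2 in \<sigma> i *\<^sub>R (\<sigma> p *\<^sub>R y (2 * p) +
     ((real i - real p) / (real q - real p)) *\<^sub>R (\<sigma> q *\<^sub>R y (2 * q) - \<sigma> p *\<^sub>R (y (2 * p) :: real^3))))"
  define S where "S = (\<lambda>i. 2 * i) ` ({..<5} - {p,q})"
  define Q where "Q = (\<lambda>y. \<forall>j\<in>S. y j \<in> cball (L j y) (80 * r))"
  \<comment> \<open>For \<open>j = 2 * i + 1\<close>, the centre is the first increment of the
    progression at \<open>t\<close>, minus all terms of its \<open>i\<close>-th increment other than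
    \<open>Y j\<close>.\<close>
  define g where "g = (\<lambda>j y. y 1 + (1 - a 0) *\<^sub>R y 0 + a 1 *\<^sub>R y 2
     - (1 - a (j div 2)) *\<^sub>R y (j - 1) - a (Suc (j div 2)) *\<^sub>R (y (Suc j) :: real^3))"
  \<comment> \<open>The even indices give all displacements; index 1 is added because the first
    increment of the progression involves \<open>Y 1\<close>. The bridges 3, 5, 7 remain independent
    of these.\<close>
  define B where "B = {0,1,2,4,6,8::nat}"
  have S: "S \<subseteq> {0,2,4,6,8}" by (auto simp: S_def)
  have finS [simp]: "finite S" by (simp add: S_def)
  have SB: "S \<subseteq> B" using S by (auto simp: B_def)
  have pqB: "2 * p \<in> B" "2 * q \<in> B" using pq by (auto simp: B_def)
  have [measurable]: "(\<lambda>y. y (2 * p)) \<in> measurable (PiM {2*p,2*q} (\<lambda>_. borel)) borel"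
     "(\<lambda>y. y (2 * q)) \<in> measurable (PiM {2*p,2*q} (\<lambda>_. borel)) borel"
     "(\<lambda>y. y (2 * p)) \<in> measurable (PiM B (\<lambda>_. borel)) borel"
     "(\<lambda>y. y (2 * q)) \<in> measurable (PiM B (\<lambda>_. borel)) borel"
    using pqB by (auto intro: measurable_component_singleton)
  have L1 [measurable]: "L j \<in> measurable (PiM {2*p,2*q} (\<lambda>_. borel)) borel" for j
    unfolding L_def Let_def by measurable
  have L2 [measurable]: "L j \<in> measurable (PiM B (\<lambda>_. borel)) borel" for j
    unfolding L_def Let_def by measurable
  have Qm: "Measurable.pred (PiM B (\<lambda>_. borel)) Q"
    unfolding Q_def mem_cball
  proof (rule pred_intros_finite(3)[OF finS])
    fix j assume "j \<in> S"
    then have [measurable]: "(\<lambda>y. y j) \<in> measurable (PiM B (\<lambda>_. borel :: (real^3) measure)) borel"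
      using SB by (auto intro: measurable_component_singleton)
    show "Measurable.pred (PiM B (\<lambda>_. borel)) (\<lambda>y. dist (L j y) (y j) \<le> 80 * r)" by measurable
  qed
  have sub: "near_prog r t \<inter> near_prog r s \<subseteq>
    {\<omega> \<in> space M. Q (\<lambda>i\<in>B. Y i \<omega>) \<and> (\<forall>j\<in>{3,5,7}. Y j \<omega> \<in> cball (g j (\<lambda>i\<in>B. Y i \<omega>)) r)}"
  proof
    fix \<omega> assume w: "\<omega> \<in> near_prog r t \<inter> near_prog r s"
    then have "\<omega> \<in> space M" by (simp add: near_prog_def)
    define T where "T = (\<lambda>i. W (t (Suc i)) \<omega> - W (t i) \<omega>)"
    define U where "U = (\<lambda>i. W (s (Suc i)) \<omega> - W (s i) \<omega>)"
    have TU: "norm (T 0 - T i) \<le> r" "norm (U 0 - U i) \<le> r" if "i \<in> {1,2,3}" for i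
      using w that unfolding near_prog_def T_def U_def by (auto simp: dist_norm)
    have T: "T i = Y (2 * i + 1) \<omega> + (1 - a i) *\<^sub>R Y (2 * i) \<omega> + a (Suc i) *\<^sub>R Y (2 * Suc i) \<omega>" for i
      unfolding T_def Wt W\<tau> by (simp add: algebra_simps)
    have U: "U i = Y (2 * i + 1) \<omega> + a i *\<^sub>R Y (2 * i) \<omega> + (1 - a (Suc i)) *\<^sub>R Y (2 * Suc i) \<omega>" for i
      unfolding U_def Ws W\<tau> by (simp add: algebra_simps)
    \<comment> \<open>By \<open>Wt\<close> and \<open>Ws\<close>, this is the displacement
      \<open>W (s i) \<omega> - W (t i) \<omega>\<close>.\<close>
    define x where "x = (\<lambda>i. \<sigma> i *\<^sub>R Y (2 * i) \<omega>)"
    have x: "x (Suc i) - x i = U i - T i" for i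
      unfolding x_def T U \<sigma>_split scaleR_diff_left scaleR_one by (simp only: algebra_simps)
    have dx: "norm ((x (Suc i) - x i) - (x 1 - x 0)) \<le> 2 * r" if "i < 4" for i
    proof (cases "i = 0")
      case False
      with that have "i \<in> {1,2,3}" by auto
      then have "norm (T 0 - T i) + norm (U 0 - U i) \<le> 2 * r"
        using TU[of i] by linarith
      moreover have "norm ((T 0 - T i) - (U 0 - U i)) \<le> norm (T 0 - T i) + norm (U 0 - U i)"
        by (rule norm_triangle_ineq4)
      moreover have "(x (Suc i) - x i) - (x 1 - x 0) = (T 0 - T i) - (U 0 - U i)"
        unfolding One_nat_def x by (simp only: algebra_simps)
      ultimately show ?thesis by (simp only:)
    next
      case True
      show ?thesis unfolding True One_nat_def diff_self norm_zero using r by linarith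
    qed
    have "Q (\<lambda>i\<in>B. Y i \<omega>)"
      unfolding Q_def
    proof
      fix j assume j: "j \<in> S"
      then obtain i where i: "j = 2 * i" "i < 5" by (auto simp: S_def)
      let ?l = "x p + ((real i - real p) / (real q - real p)) *\<^sub>R (x q - x p)"
      \<comment> \<open>Here \<open>n = 4\<close> and the differences agree up to
        \<open>2 * r\<close>, so the rigidity bound is 2 * 4 * 5 * 2 = 40 * 2 = 80 times
        \<open>r\<close>.\<close>
      have "norm (x i - ?l) \<le> 2 * real 4 * (real 4 + 1) * (2 * r)"
        by (rule norm_nearly_affine_le[OF dx]) (use i pq r in auto)
      then have "norm (\<sigma> i *\<^sub>R (x i - ?l)) \<le> 80 * r" by (simp add: \<sigma>1)
      moreover have "\<sigma> i *\<^sub>R (x i - ?l) = Y j \<omega> - L j (\<lambda>i\<in>B. Y i \<omega>)"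
        using pqB by (simp add: i L_def x_def scaleR_diff_right \<sigma>1)
      moreover have "(\<lambda>i\<in>B. Y i \<omega>) j = Y j \<omega>" using j SB by auto
      ultimately show "(\<lambda>i\<in>B. Y i \<omega>) j \<in> cball (L j (\<lambda>i\<in>B. Y i \<omega>)) (80 * r)"
        by (simp add: dist_norm norm_minus_commute)
    qed
    moreover have "Y j \<omega> \<in> cball (g j (\<lambda>i\<in>B. Y i \<omega>)) r" if j: "j \<in> {3,5,7}" for j
    proof -
      obtain i where i: "j = 2 * i + 1" "i \<in> {1,2,3}" using j by (elim insertE) (auto intro: that[of 1] that[of 2] that[of 3])
      have "2 * i \<in> B" "2 * Suc i \<in> B" "0 \<in> B" "1 \<in> B" "2 \<in> B" using i by (auto simp: B_def)
      moreover have jd: "j div 2 = i" "j - 1 = 2 * i" "Suc j = 2 * Suc i" using i by simp_all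
      ultimately have "g j (\<lambda>i\<in>B. Y i \<omega>) - Y j \<omega> = T 0 - T i"
        unfolding g_def jd T i(1) by (simp add: algebra_simps numeral_2_eq_2)
      then show ?thesis using TU[OF i(2)] by (simp add: dist_norm)
    qed
    ultimately show "\<omega> \<in> {\<omega> \<in> space M. Q (\<lambda>i\<in>B. Y i \<omega>) \<and> (\<forall>j\<in>{3,5,7}. Y j \<omega> \<in> cball (g j (\<lambda>i\<in>B. Y i \<omega>)) r)}"
      using \<open>\<omega> \<in> space M\<close> by (intro CollectI conjI ballI)
  qed
  have \<beta>0: "0 \<le> \<beta> i" if "i < 5" for i
    using \<beta>[OF that, of 0] measure_nonneg order_trans by blast
  \<comment> \<open>First stage of the conditioning: \<open>L\<close> reads only the coordinates
    \<open>2 * p\<close> and \<open>2 * q\<close>, so the other even increments can be estimated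
    given these two. The second stage fixes all of \<open>B\<close> and estimates the increments 3,
    5, 7.\<close>
  have "{\<omega> \<in> space M. Q (\<lambda>i\<in>B. Y i \<omega>)} =
      {\<omega> \<in> space M. True \<and> (\<forall>j\<in>S. Y j \<omega> \<in> cball (L j (\<lambda>i\<in>{2*p,2*q}. Y i \<omega>)) (80 * r))}"
    using SB pqB by (intro Collect_cong) (auto simp: Q_def L_def Let_def)
  also have "prob \<dots> \<le> prob {\<omega> \<in> space M. True} * (\<Prod>j\<in>S. \<beta> (j div 2))"
  proof (rule prob_indep_vars_cball_le[OF ind, where Q = "\<lambda>_. True"])
    show "{2 * p, 2 * q} \<inter> S = {}" by (auto simp: S_def)
    fix j y assume "j \<in> S"
    then obtain i where i: "j = 2 * i" "i < 5" by (auto simp: S_def)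
    then have "Y j = (\<lambda>\<omega>. W (max (t i) (s i)) \<omega> - W (min (t i) (s i)) \<omega>)"
      by (simp add: Y_def \<tau>_def)
    then show "prob {\<omega> \<in> space M. Y j \<omega> \<in> cball (L j y) (80 * r)} \<le> \<beta> (j div 2)"
      using \<beta>[of i] i by simp
  qed (use pq S in \<open>auto simp: \<beta>0 dest!: subsetD[OF S]\<close>)
  also have "\<dots> = (\<Prod>i\<in>{..<5} - {p,q}. \<beta> i)"
    unfolding S_def by (subst prod.reindex) (auto simp: prob_space inj_on_def)
  finally have PQ: "prob {\<omega> \<in> space M. Q (\<lambda>i\<in>B. Y i \<omega>)} \<le> (\<Prod>i\<in>{..<5} - {p,q}. \<beta> i)" .
  have Ym: "random_variable borel (Y i)" if "i < 9" for i
    using that pos[of i] pos[of "Suc i"] unfolding Y_def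
    by (intro borel_measurable_diff random_variable_W) auto
  have gm: "g j \<in> measurable (PiM B (\<lambda>_. borel)) borel" if "j \<in> {3,5,7}" for j
  proof -
    have "0 \<in> B" "1 \<in> B" "2 \<in> B" "j - 1 \<in> B" "Suc j \<in> B" using that by (auto simp: B_def)
    note [measurable] = this[THEN measurable_component_singleton[of _ B "\<lambda>_. borel :: (real^3) measure"]]
    show ?thesis unfolding g_def by measurable
  qed
  have Yrm: "(\<lambda>\<omega>. \<lambda>i\<in>B. Y i \<omega>) \<in> measurable M (PiM B (\<lambda>_. borel))"
    by (rule measurable_restrict) (auto simp: B_def intro: Ym)
  have "prob (near_prog r t \<inter> near_prog r s) \<le>
    prob {\<omega> \<in> space M. Q (\<lambda>i\<in>B. Y i \<omega>) \<and> (\<forall>j\<in>{3,5,7}. Y j \<omega> \<in> cball (g j (\<lambda>i\<in>B. Y i \<omega>)) r)}"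
  proof (rule finite_measure_mono[OF sub])
    have [measurable]: "Measurable.pred M (\<lambda>\<omega>. Q (\<lambda>i\<in>B. Y i \<omega>))"
      by (rule measurable_compose[OF Yrm Qm])
    have [measurable]: "random_variable borel (\<lambda>\<omega>. g j (\<lambda>i\<in>B. Y i \<omega>))" "random_variable borel (Y j)" if "j \<in> {3,5,7}" for j
      using that by (auto intro!: measurable_compose[OF Yrm gm] Ym)
    show "{\<omega> \<in> space M. Q (\<lambda>i\<in>B. Y i \<omega>) \<and> (\<forall>j\<in>{3,5,7}. Y j \<omega> \<in> cball (g j (\<lambda>i\<in>B. Y i \<omega>)) r)} \<in> events"
      unfolding mem_cball by measurable
  qed
  also have "\<dots> \<le> prob {\<omega> \<in> space M. Q (\<lambda>i\<in>B. Y i \<omega>)} * (\<Prod>j\<in>{3,5,7::nat}. unit_ball_vol 3 * r ^ 3)"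
  proof (rule prob_indep_vars_cball_le[OF ind _ _ _ _ Qm gm])
    fix j :: nat and y assume j: "j \<in> {3,5,7}"
    then have st: "1 \<le> \<tau> (Suc j) - \<tau> j" using step[of j] by auto
    have "prob {\<omega> \<in> space M. Y j \<omega> \<in> cball (g j y) r} \<le> unit_ball_vol (real CARD(3)) * (r / sqrt (\<tau> (Suc j) - \<tau> j)) ^ CARD(3)"
      unfolding Y_def by (rule prob_increment_cball_le) (use st r j pos[of j] in auto)
    also have "\<dots> \<le> unit_ball_vol 3 * r ^ 3"
    proof -
      have "r / sqrt (\<tau> (Suc j) - \<tau> j) \<le> r / 1"
        using st r by (intro divide_left_mono) auto
      then show ?thesis using st r by (auto intro!: mult_left_mono power_mono)
    qed
    finally show "prob {\<omega> \<in> space M. Y j \<omega> \<in> cball (g j y) r} \<le> unit_ball_vol 3 * r ^ 3" .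
  qed (use r in \<open>auto simp: B_def\<close>)
  also have "\<dots> \<le> (\<Prod>i\<in>{..<5} - {p,q}. \<beta> i) * (\<Prod>j\<in>{3,5,7::nat}. unit_ball_vol 3 * r ^ 3)"
    by (rule mult_right_mono[OF PQ]) (use r in auto)
  finally show ?thesis by (simp add: power3_eq_cube mult_ac)
qed

end

section \<open>Geometric mean and sums of negative powers of distances\<close>

lemma prod_le_geometric_mean:
  fixes \<beta> :: "nat \<Rightarrow> real"
  assumes x: "0 \<le> x" and A: "0 \<le> A" and \<beta>: "\<And>i. i < 5 \<Longrightarrow> 0 \<le> \<beta> i"
    and le: "\<And>p q. p < 5 \<Longrightarrow> q < 5 \<Longrightarrow> p \<noteq> q \<Longrightarrow> x \<le> (\<Prod>i\<in>{..<5} - {p,q}. \<beta> i) * A"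
  shows "x ^ 5 \<le> (\<Prod>i<5. \<beta> i) ^ 3 * A ^ 5"
proof -
  \<comment> \<open>Multiply the five bounds for cyclically adjacent \<open>p\<close>, \<open>q\<close>: every index survives in three of them.\<close>
  have s: "{..<5} - {0,1} = {2,3,4::nat}" "{..<5} - {1,2} = {0,3,4::nat}" "{..<5} - {2,3} = {0,1,4::nat}"
    "{..<5} - {3,4} = {0,1,2::nat}" "{..<5} - {4,0} = {1,2,3::nat}" by auto
  have b: "0 \<le> \<beta> 0" "0 \<le> \<beta> 1" "0 \<le> \<beta> 2" "0 \<le> \<beta> 3" "0 \<le> \<beta> 4" by (simp_all add: \<beta>)
  have "x * x * x * x * x \<le> (\<beta> 2 * \<beta> 3 * \<beta> 4 * A) * (\<beta> 0 * \<beta> 3 * \<beta> 4 * A) * (\<beta> 0 * \<beta> 1 * \<beta> 4 * A)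
     * (\<beta> 0 * \<beta> 1 * \<beta> 2 * A) * (\<beta> 1 * \<beta> 2 * \<beta> 3 * A)"
    using le[of 0 1, unfolded s] le[of 1 2, unfolded s] le[of 2 3, unfolded s]
      le[of 3 4, unfolded s] le[of 4 0, unfolded s] x A b
    by (intro mult_mono) (simp_all add: mult_ac)
  then show ?thesis by (simp add: eval_nat_numeral lessThan_Suc mult_ac)
qed

text \<open>Integral comparison: by the mean value theorem each term with \<open>d > 0\<close> is at
  most the increment of \<open>10 * x powr (1/10)\<close>. The leading 1 is the term
  \<open>d = 0\<close>.\<close>

lemma sum_powr_minus_nine_tenths_le:
  "(\<Sum>d\<le>n. max 1 (real d) powr (- 9/10)) \<le> 1 + 10 * real n powr (1/10)"
proof (induction n)
  case (Suc n)
  have "real (Suc n) powr (- 9/10) \<le> 10 * (real (Suc n) powr (1/10) - real n powr (1/10))"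
  \<comment> \<open>The power is not differentiable at 0. For \<open>n = 0\<close> the claim reduces
    to 1 being at most 10, as \<open>0 powr (1/10) = 0\<close>.\<close>
  proof (cases "n = 0")
    case False
    have "\<exists>z>real n. z < real (Suc n) \<and> real (Suc n) powr (1/10) - real n powr (1/10)
       = (real (Suc n) - real n) * (1/10 * z powr (1/10 - 1))"
      by (rule MVT2) (use False in \<open>auto intro!: derivative_eq_intros simp: powr_diff\<close>)
    then obtain z where z: "real n < z" "z < real (Suc n)"
      "real (Suc n) powr (1/10) - real n powr (1/10) = 1/10 * z powr (- 9/10)"
      by auto
    then have "real (Suc n) powr (- 9/10) \<le> z powr (- 9/10)"
      by (intro powr_mono2') auto
    with z show ?thesis by simp
  qed simp
  with Suc show ?case by simp
qed simp

text \<open>The indices on either side of \<open>a\<close> each give at most one copy of the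
  previous sum, and the constant 2 is absorbed since
  \<open>1 \<le> real m powr (1/10)\<close>.\<close>

lemma sum_dist_powr_minus_nine_tenths_le:
  assumes "a < m"
  shows "(\<Sum>b<m. max 1 \<bar>real a - real b\<bar> powr (- 9/10)) \<le> 22 * real m powr (1/10)"
proof -
  define f where "f = (\<lambda>d::nat. max 1 (real d) powr (- 9/10))"
  have f: "max 1 \<bar>real a - real b\<bar> powr (- 9/10) = f (if b \<le> a then a - b else b - a)" for b
    by (auto simp: f_def of_nat_diff)
  have "(\<Sum>b<m. max 1 \<bar>real a - real b\<bar> powr (- 9/10)) =
      (\<Sum>b\<in>{..a}. f (a - b)) + (\<Sum>b\<in>{a<..<m}. f (b - a))"
  proof -
    have un: "{..<m} = {..a} \<union> {a<..<m}" using assms by auto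
    have "sum h {..<m} = sum h {..a} + sum h {a<..<m}" for h :: "nat \<Rightarrow> real"
      unfolding un by (rule sum.union_disjoint) auto
    then show ?thesis unfolding f by simp
  qed
  also have "(\<Sum>b\<in>{..a}. f (a - b)) = (\<Sum>d\<in>{..a}. f d)"
    by (rule sum.reindex_bij_witness[of _ "\<lambda>d. a - d" "\<lambda>d. a - d"]) auto
  also have "(\<Sum>b\<in>{a<..<m}. f (b - a)) = (\<Sum>d\<in>{0<..<m-a}. f d)"
    by (rule sum.reindex_bij_witness[of _ "\<lambda>d. d + a" "\<lambda>d. d - a"]) auto
  also have "(\<Sum>d\<in>{..a}. f d) \<le> (\<Sum>d\<le>m. f d)"
    using assms by (intro sum_mono2) (auto simp: f_def)
  also have "(\<Sum>d\<in>{0<..<m-a}. f d) \<le> (\<Sum>d\<le>m. f d)"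
    by (intro sum_mono2) (auto simp: f_def)
  also have "(\<Sum>d\<le>m. f d) \<le> 1 + 10 * real m powr (1/10)"
    unfolding f_def by (rule sum_powr_minus_nine_tenths_le)
  finally have "(\<Sum>b<m. max 1 \<bar>real a - real b\<bar> powr (- 9/10)) \<le> 2 * (1 + 10 * real m powr (1/10))"
    by simp
  moreover have "1 \<le> real m powr (1/10)"
    using assms by (intro ge_one_powr_ge_zero) auto
  ultimately show ?thesis by simp
qed

section \<open>Second moment method over independent blocks\<close>

text \<open>Chebyshev's inequality for the number \<open>f\<close> of events that occur, which is 0
  outside the union. The variance is at most \<open>card I * V\<close> whereas the squared mean is
  quadratic in \<open>card I\<close>, so more blocks improve the bound.\<close>

lemma (in prob_space) prob_Union_ge_second_moment:
  fixes E :: "'i \<Rightarrow> 'j \<Rightarrow> 'a set"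
  assumes fin: "finite I" "finite T" and I: "I \<noteq> {}"
    and E [measurable]: "\<And>i k. i \<in> I \<Longrightarrow> k \<in> T \<Longrightarrow> E i k \<in> events"
    and cross: "\<And>i j k l. i \<in> I \<Longrightarrow> j \<in> I \<Longrightarrow> i \<noteq> j \<Longrightarrow> k \<in> T \<Longrightarrow> l \<in> T \<Longrightarrow>
       prob (E i k \<inter> E j l) \<le> prob (E i k) * prob (E j l)"
    and mean: "\<And>i. i \<in> I \<Longrightarrow> \<mu> \<le> (\<Sum>k\<in>T. prob (E i k))" and \<mu>: "0 < \<mu>"
    and second: "\<And>i. i \<in> I \<Longrightarrow> (\<Sum>k\<in>T. \<Sum>l\<in>T. prob (E i k \<inter> E i l)) \<le> V"
  shows "1 - V / (real (card I) * \<mu>\<^sup>2) \<le> prob (\<Union>i\<in>I. \<Union>k\<in>T. E i k)"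
proof -
  define f where "f = (\<lambda>\<omega>. \<Sum>i\<in>I. \<Sum>k\<in>T. indicator (E i k) \<omega> :: real)"
  define e where "e = (\<lambda>i. \<Sum>k\<in>T. prob (E i k))"
  have int: "integrable M (indicator (E i k) :: 'a \<Rightarrow> real)" if "i \<in> I" "k \<in> T" for i k
    using E[OF that] by (simp add: integrable_indicator_iff emeasure_eq_measure)
  have f [measurable]: "random_variable borel f"
    unfolding f_def by measurable
  have Ef: "expectation f = sum e I"
    unfolding f_def e_def using int by (simp add: Bochner_Integration.integral_sum)
  have f2: "(f \<omega>)\<^sup>2 = (\<Sum>i\<in>I. \<Sum>j\<in>I. \<Sum>k\<in>T. \<Sum>l\<in>T. indicator (E i k \<inter> E j l) \<omega>)" for \<omega>
    unfolding f_def power2_eq_square by (simp add: sum_product indicator_inter_arith)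
  have int2: "integrable M (indicator (E i k \<inter> E j l) :: 'a \<Rightarrow> real)"
    if "i \<in> I" "j \<in> I" "k \<in> T" "l \<in> T" for i j k l
    using E[of i k] E[of j l] that by (simp add: integrable_indicator_iff emeasure_eq_measure sets.Int)
  have if2: "integrable M (\<lambda>\<omega>. (f \<omega>)\<^sup>2)"
    unfolding f2 by (intro Bochner_Integration.integrable_sum int2)
  have "expectation (\<lambda>\<omega>. (f \<omega>)\<^sup>2) = (\<Sum>i\<in>I. \<Sum>j\<in>I. \<Sum>k\<in>T. \<Sum>l\<in>T. prob (E i k \<inter> E j l))"
    unfolding f2 using int2 E
    by (simp add: Bochner_Integration.integral_sum Bochner_Integration.integrable_sum sets.Int)
  \<comment> \<open>Adding the nonnegative \<open>e i * e i\<close> on the diagonal as well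
    completes the double sum to the square of the mean, which cancels in the variance.\<close>
  also have "\<dots> \<le> (\<Sum>i\<in>I. \<Sum>j\<in>I. (if i = j then V else 0) + e i * e j)"
  proof (intro sum_mono)
    fix i j assume ij: "i \<in> I" "j \<in> I"
    have nn: "0 \<le> e i * e j" unfolding e_def by (intro mult_nonneg_nonneg sum_nonneg) auto
    show "(\<Sum>k\<in>T. \<Sum>l\<in>T. prob (E i k \<inter> E j l)) \<le> (if i = j then V else 0) + e i * e j"
    proof (cases "i = j")
      case True
      with second[OF ij(1)] show ?thesis by (simp add: add_increasing2)
    next
      case False
      have "(\<Sum>k\<in>T. \<Sum>l\<in>T. prob (E i k \<inter> E j l)) \<le> (\<Sum>k\<in>T. \<Sum>l\<in>T. prob (E i k) * prob (E j l))"
        using ij False by (intro sum_mono cross)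
      with False show ?thesis by (simp add: e_def sum_product)
    qed
  qed
  also have "\<dots> = real (card I) * V + (sum e I)\<^sup>2"
    using fin by (simp add: sum.distrib sum_product power2_eq_square)
  finally have var: "variance f \<le> real (card I) * V"
    by (subst variance_eq) (use if2 square_integrable_imp_integrable[OF f if2] in \<open>simp_all add: Ef\<close>)
  have cI: "0 < real (card I)" using fin I by (simp add: card_gt_0_iff)
  have "real (card I) * \<mu> = (\<Sum>i\<in>I. \<mu>)" by simp
  also have "\<dots> \<le> sum e I" unfolding e_def by (intro sum_mono mean)
  finally have mu: "real (card I) * \<mu> \<le> sum e I" .
  have mu0: "0 < real (card I) * \<mu>" using cI \<mu> by simp
  then have e0: "0 < sum e I" using mu by linarith
  have U: "(\<Union>i\<in>I. \<Union>k\<in>T. E i k) \<in> events"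
    using fin E by (intro sets.finite_UN) auto
  have V0: "0 \<le> V"
  proof -
    obtain i where "i \<in> I" using I by blast
    have "0 \<le> (\<Sum>k\<in>T. \<Sum>l\<in>T. prob (E i k \<inter> E i l))" by (intro sum_nonneg measure_nonneg)
    also have "\<dots> \<le> V" by (rule second) fact
    finally show ?thesis .
  qed
  have "prob (space M - (\<Union>i\<in>I. \<Union>k\<in>T. E i k)) \<le> prob {\<omega> \<in> space M. sum e I \<le> \<bar>f \<omega> - expectation f\<bar>}"
  proof (rule finite_measure_mono)
    show "space M - (\<Union>i\<in>I. \<Union>k\<in>T. E i k) \<subseteq> {\<omega> \<in> space M. sum e I \<le> \<bar>f \<omega> - expectation f\<bar>}"
    proof
      fix \<omega> assume w: "\<omega> \<in> space M - (\<Union>i\<in>I. \<Union>k\<in>T. E i k)"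
      then have "f \<omega> = 0" by (auto simp: f_def intro!: sum.neutral)
      with w e0 show "\<omega> \<in> {\<omega> \<in> space M. sum e I \<le> \<bar>f \<omega> - expectation f\<bar>}"
        by (simp add: Ef)
    qed
  qed measurable
  also have "\<dots> \<le> variance f / (sum e I)\<^sup>2"
    by (rule Chebyshev_inequality[OF f if2 e0])
  also have "\<dots> \<le> (real (card I) * V) / (real (card I) * \<mu>)\<^sup>2"
    using var mu mu0 V0 cI by (intro frac_le power_mono) auto
  also have "\<dots> = V / (real (card I) * \<mu>\<^sup>2)"
    using cI by (simp add: power2_eq_square field_simps)
  finally show ?thesis
    using U by (simp add: prob_compl)
qed

section \<open>Compactness: from approximate to exact progressions\<close>

text \<open>The total distance of the points to \<open>C\<close> is continuous in the first two
  points, which range over a compact set. Its minimum is attained and must be 0; the closed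
  condition that these points are at distance at least 1 keeps the step nonzero.\<close>

lemma contains_arith_prog_of_approx:
  fixes C :: "(real ^ 'n) set"
  assumes C: "compact C" and m: "1 < m"
    and approx: "\<And>\<epsilon>. 0 < \<epsilon> \<Longrightarrow> \<exists>a\<in>C. \<exists>b\<in>C. 1 \<le> dist a b \<and> (\<forall>j<m. infdist (a + real j *\<^sub>R (b - a)) C \<le> \<epsilon>)"
  shows "contains_arith_prog m C"
proof -
  define K where "K = (C \<times> C) \<inter> {p. 1 \<le> dist (fst p) (snd p)}"
  define \<phi> where "\<phi> = (\<lambda>p. \<Sum>j<m. infdist (fst p + real j *\<^sub>R (snd p - fst p)) C)"
  have "closed {p :: (real^'n) \<times> (real^'n). 1 \<le> dist (fst p) (snd p)}"
    by (intro closed_Collect_le continuous_intros)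
  then have "compact K"
    unfolding K_def by (intro compact_Int_closed compact_Times C)
  moreover have "K \<noteq> {}" using approx[of 1] by (auto simp: K_def)
  moreover have "continuous_on K \<phi>"
    unfolding \<phi>_def by (intro continuous_intros)
  ultimately obtain p where p: "p \<in> K" "\<And>q. q \<in> K \<Longrightarrow> \<phi> p \<le> \<phi> q"
    using continuous_attains_inf[of K \<phi>] by blast
  have "\<phi> p \<le> \<epsilon>" if "0 < \<epsilon>" for \<epsilon>
  proof -
    have "0 < \<epsilon> / real m" using that m by simp
    from approx[OF this] obtain a b where ab: "a \<in> C" "b \<in> C" "1 \<le> dist a b"
      "\<And>j. j < m \<Longrightarrow> infdist (a + real j *\<^sub>R (b - a)) C \<le> \<epsilon> / real m" by blast
    have "\<phi> p \<le> \<phi> (a, b)" using ab by (intro p) (auto simp: K_def)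
    also have "\<dots> \<le> (\<Sum>j<m. \<epsilon> / real m)"
      unfolding \<phi>_def by (intro sum_mono) (simp add: ab)
    finally show ?thesis using m by simp
  qed
  then have "\<phi> p \<le> 0" by (meson dense_ge)
  moreover have "0 \<le> \<phi> p" unfolding \<phi>_def by (intro sum_nonneg) (simp add: infdist_nonneg)
  ultimately have "\<phi> p = 0" by simp
  then have "infdist (fst p + real j *\<^sub>R (snd p - fst p)) C = 0" if "j < m" for j
    using that unfolding \<phi>_def by (subst (asm) sum_nonneg_eq_0_iff) (auto simp: infdist_nonneg)
  moreover have "closed C" "C \<noteq> {}" using C p by (auto simp: K_def compact_imp_closed)
  ultimately have "fst p + real j *\<^sub>R (snd p - fst p) \<in> C" if "j < m" for j
    using that in_closed_iff_infdist_zero by blast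
  moreover have "snd p - fst p \<noteq> 0" using p by (auto simp: K_def)
  ultimately show ?thesis unfolding contains_arith_prog_def by blast
qed

section \<open>The time grid and moment bounds uniform in the mesh\<close>

lemma inverse_sqrt_power_eq_powr:
  assumes "0 < x" shows "(1 / sqrt x) ^ n = x powr (- real n / 2)"
proof -
  have "1 / sqrt x = x powr (- 1/2)"
    using assms by (simp add: powr_minus_divide powr_half_sqrt)
  then show ?thesis using assms by (simp add: powr_power)
qed

text \<open>Extensional functions make the set finite and let sums of products over it factor
  coordinatewise.\<close>

definition grid :: "nat \<Rightarrow> (nat \<Rightarrow> nat) set" where
  "grid m = {..<5} \<rightarrow>\<^sub>E {..<m}"

text \<open>Unit intervals starting at even offsets keep consecutive times between 1 and 3 apart.
  Block \<open>n\<close> ends by \<open>10 * n + 9\<close>, before the next block starts.\<close>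

definition grid_time :: "nat \<Rightarrow> nat \<Rightarrow> (nat \<Rightarrow> nat) \<Rightarrow> nat \<Rightarrow> real" where
  "grid_time m n k i = 10 * real n + 2 * real i + real (k i) / real m"

lemma finite_grid [simp]: "finite (grid m)"
  by (simp add: grid_def finite_PiE)

lemma card_grid: "card (grid m) = m ^ 5"
  by (simp add: grid_def card_PiE)

lemma grid_time_bounds:
  assumes "k \<in> grid m" "i < 5"
  shows "10 * real n + 2 * real i \<le> grid_time m n k i" "grid_time m n k i \<le> 10 * real n + 2 * real i + 1"
proof -
  have "k i < m" using assms by (auto simp: grid_def)
  then show "10 * real n + 2 * real i \<le> grid_time m n k i" "grid_time m n k i \<le> 10 * real n + 2 * real i + 1"
    by (simp_all add: grid_time_def)
qed

context brownian_motion_3d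
begin

text \<open>At this radius the mesh cancels: times \<open>d / m\<close> apart give a ball
  probability of order \<open>d powr (- 3/2)\<close>. The geometric mean keeps three indices out of
  five, turning the exponent 3/2 into 9/10.\<close>

lemma prob_near_prog_grid_pair_le:
  fixes m n :: nat and k l :: "nat \<Rightarrow> nat"
  assumes m: "0 < m" and kl: "k \<in> grid m" "l \<in> grid m"
  defines "r \<equiv> 1 / sqrt (real m)" and "C \<equiv> max 1 (unit_ball_vol 3 * 80 ^ 3)"
  shows "prob (near_prog r (grid_time m n k) \<inter> near_prog r (grid_time m n l)) \<le>
    (unit_ball_vol 3 * r ^ 3) ^ 3 * C ^ 3 * (\<Prod>i<5. max 1 \<bar>real (k i) - real (l i)\<bar> powr (- 9/10))"
proof -
  define t where "t = grid_time m n k"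
  define s where "s = grid_time m n l"
  define d where "d = (\<lambda>i. max 1 \<bar>real (k i) - real (l i)\<bar>)"
  define \<beta> where "\<beta> = (\<lambda>i. C * d i powr (- 3/2))"
  define A where "A = (unit_ball_vol 3 * r ^ 3) ^ 3"
  have r: "0 < r" using m by (simp add: r_def)
  have d1: "1 \<le> d i" for i by (simp add: d_def)
  have C: "1 \<le> C" by (simp add: C_def)
  have A: "0 \<le> A" using r by (simp add: A_def)
  have \<beta>: "prob {\<omega> \<in> space M. W (max (t i) (s i)) \<omega> - W (min (t i) (s i)) \<omega> \<in> cball z (80 * r)} \<le> \<beta> i"
    if i: "i < 5" for i z
  proof (cases "k i = l i")
    \<comment> \<open>Equal times leave no randomness, so only the trivial bound 1 is available;
      hence the \<open>max 1\<close> in \<open>C\<close> and in \<open>d\<close>.\<close>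
    case True
    then have "d i = 1" by (simp add: d_def)
    then have "1 \<le> \<beta> i" using C by (simp add: \<beta>_def)
    then show ?thesis using prob_le_1 order_trans by blast
  next
    case False
    have di: "d i = \<bar>real (k i) - real (l i)\<bar>" using False by (auto simp: d_def)
    have ts: "t i - s i = (real (k i) - real (l i)) / real m"
      by (simp add: t_def s_def grid_time_def diff_divide_distrib)
    have "max (t i) (s i) - min (t i) (s i) = \<bar>t i - s i\<bar>" by auto
    also have "\<dots> = d i / real m" using m by (simp add: ts di)
    finally have mm: "max (t i) (s i) - min (t i) (s i) = d i / real m" .
    have dm: "0 < d i / real m" using m d1[of i] by simp
    have "prob {\<omega> \<in> space M. W (max (t i) (s i)) \<omega> - W (min (t i) (s i)) \<omega> \<in> cball z (80 * r)}
      \<le> unit_ball_vol (real CARD(3)) * ((80 * r) / sqrt (max (t i) (s i) - min (t i) (s i))) ^ CARD(3)"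
    proof (rule prob_increment_cball_le)
      show "0 \<le> min (t i) (s i)"
        using grid_time_bounds(1)[OF kl(1) i, of n] grid_time_bounds(1)[OF kl(2) i, of n]
        by (simp add: t_def s_def)
      show "min (t i) (s i) < max (t i) (s i)" using mm dm by linarith
    qed (use r in simp)
    also have "\<dots> = unit_ball_vol 3 * (80 * (1 / sqrt (d i))) ^ 3"
      unfolding mm using m d1[of i] by (simp add: r_def real_sqrt_divide)
    also have "\<dots> = unit_ball_vol 3 * 80 ^ 3 * d i powr (- 3/2)"
      unfolding power_mult_distrib using inverse_sqrt_power_eq_powr[of "d i" 3] d1[of i] by simp
    also have "\<dots> \<le> \<beta> i"
      unfolding \<beta>_def C_def by (intro mult_right_mono) auto
    finally show ?thesis .
  qed
  have "prob (near_prog r t \<inter> near_prog r s) ^ 5 \<le> (\<Prod>i<5. \<beta> i) ^ 3 * A ^ 5"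
  proof (rule prod_le_geometric_mean)
    fix p q :: nat assume pq: "p < 5" "q < 5" "p \<noteq> q"
    show "prob (near_prog r t \<inter> near_prog r s) \<le> (\<Prod>i\<in>{..<5} - {p,q}. \<beta> i) * A"
      unfolding A_def
      by (rule prob_near_prog_pair_le[OF _ _ _ _ \<beta> pq, of "10 * real n"])
         (use r grid_time_bounds[OF kl(1)] grid_time_bounds[OF kl(2)] in \<open>simp_all add: t_def s_def\<close>)
  qed (use A C in \<open>simp_all add: \<beta>_def\<close>)
  also have "\<dots> = (A * C ^ 3 * (\<Prod>i<5. d i powr (- 9/10))) ^ 5"
  proof -
    have "(d i powr (- 3/2)) ^ 3 = (d i powr (- 9/10)) ^ 5" for i
      using d1[of i] by (simp add: powr_power)
    then have "(\<Prod>i<5. d i powr (- 3/2)) ^ 3 = (\<Prod>i<5. d i powr (- 9/10)) ^ 5"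
      unfolding prod_power_distrib by simp
    then show ?thesis
      by (simp add: \<beta>_def prod.distrib power_mult_distrib mult_ac flip: power_mult)
  qed
  finally have "prob (near_prog r t \<inter> near_prog r s) \<le> A * C ^ 3 * (\<Prod>i<5. d i powr (- 9/10))"
    by (rule power_le_imp_le_base[where n = 4, simplified])
       (use A C in \<open>auto intro!: mult_nonneg_nonneg prod_nonneg\<close>)
  then show ?thesis by (simp add: A_def d_def t_def s_def)
qed

text \<open>In each block the mean is at least of order \<open>sqrt m\<close> and the second moment
  at most of order \<open>m\<close>, so \<open>m\<close> drops out of the ratio and \<open>C\<close>
  depends on neither \<open>m\<close> nor \<open>N\<close>.\<close>

lemma prob_Union_near_prog_grid_ge:
  obtains C where "0 < C" "\<And>m N. 0 < m \<Longrightarrow> 0 < N \<Longrightarrow>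
    1 - C / real N \<le> prob (\<Union>n<N. \<Union>k\<in>grid m. near_prog (1 / sqrt (real m)) (grid_time m n k))"
proof -
  define K where "K = unit_ball_vol 3"
  define B where "B = K ^ 3 * max 1 (K * 80 ^ 3) ^ 3 * 22 ^ 5"
  define c where "c = K ^ 4 * (exp (- 8) / sqrt (6 * pi)) ^ 12"
  have K: "0 < K" by (simp add: K_def)
  have B: "0 < B" unfolding B_def using K by (intro mult_pos_pos zero_less_power) auto
  have c: "0 < c" unfolding c_def using K by (intro mult_pos_pos zero_less_power divide_pos_pos) auto
  have "1 - B / c\<^sup>2 / real N \<le> prob (\<Union>n<N. \<Union>k\<in>grid m. near_prog (1 / sqrt (real m)) (grid_time m n k))"
    if m: "0 < m" and N: "0 < N" for m N
  proof -
    define r where "r = 1 / sqrt (real m)"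
    define E where "E = (\<lambda>n k. near_prog r (grid_time m n k))"
    \<comment> \<open>Number of grid points times the order of one probability; it equals
      \<open>sqrt m\<close>.\<close>
    define x where "x = real m ^ 5 * r ^ 9"
    have r: "0 < r" "r \<le> 1" using m by (auto simp: r_def)
    have x0: "0 < x" using m r by (simp add: x_def)
    \<comment> \<open>The exponents match here: five coordinate sums of order
      \<open>real m powr (1/10)\<close> multiply to the same \<open>x\<close>, making the second
      moment comparable to the squared mean.\<close>
    have mid: "(real m powr (1/10)) ^ 5 = x"
    proof -
      have "x = real m powr 5 * real m powr (- 9/2)"
        unfolding x_def r_def using m inverse_sqrt_power_eq_powr[of "real m" 9] by simp
      also have "\<dots> = real m powr (5 + - 9/2)" by (rule powr_add[symmetric])
      also have "\<dots> = real m powr (1/2)" by simp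
      finally show ?thesis using m by (simp add: powr_power)
    qed
    have "1 - (B * x\<^sup>2) / (real (card {..<N}) * (c * x)\<^sup>2) \<le> prob (\<Union>n\<in>{..<N}. \<Union>k\<in>grid m. E n k)"
    proof (rule prob_Union_ge_second_moment)
      show "E n k \<in> events" if "k \<in> grid m" for n k
      proof -
        have "0 \<le> grid_time m n k i" for i by (simp add: grid_time_def)
        then show ?thesis unfolding E_def by (intro near_prog_sets)
      qed
      show "c * x \<le> (\<Sum>k\<in>grid m. prob (E n k))" for n
      proof -
        have "c * r ^ 9 \<le> prob (E n k)" if k: "k \<in> grid m" for k
          unfolding E_def c_def K_def
        proof (rule prob_near_prog_ge)
          fix i :: nat assume "i < 4"
          then show "1 \<le> grid_time m n k (Suc i) - grid_time m n k i \<and> grid_time m n k (Suc i) - grid_time m n k i \<le> 3"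
            using grid_time_bounds[OF k, of i n] grid_time_bounds[OF k, of "Suc i" n] by simp
        qed (use r in \<open>simp_all add: grid_time_def\<close>)
        then have "(\<Sum>k\<in>grid m. c * r ^ 9) \<le> (\<Sum>k\<in>grid m. prob (E n k))" by (intro sum_mono)
        then show ?thesis by (simp add: card_grid x_def mult_ac)
      qed
      show "(\<Sum>k\<in>grid m. \<Sum>l\<in>grid m. prob (E n k \<inter> E n l)) \<le> B * x\<^sup>2" for n
      proof -
        define D where "D = (K * r ^ 3) ^ 3 * max 1 (K * 80 ^ 3) ^ 3"
        have D: "0 \<le> D" using K r by (simp add: D_def)
        have row: "(\<Sum>l\<in>grid m. prob (E n k \<inter> E n l)) \<le> D * (22 * real m powr (1/10)) ^ 5" if k: "k \<in> grid m" for k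
        proof -
          have "(\<Sum>l\<in>grid m. prob (E n k \<inter> E n l)) \<le>
              (\<Sum>l\<in>grid m. D * (\<Prod>i<5. max 1 \<bar>real (k i) - real (l i)\<bar> powr (- 9/10)))"
            unfolding E_def D_def K_def r_def
            by (intro sum_mono prob_near_prog_grid_pair_le[OF m k])
          also have "\<dots> = D * (\<Prod>i<5. \<Sum>b<m. max 1 \<bar>real (k i) - real b\<bar> powr (- 9/10))"
            unfolding grid_def by (subst prod_sum_PiE) (auto simp: sum_distrib_left)
          also have "\<dots> \<le> D * (\<Prod>i<(5::nat). 22 * real m powr (1/10))"
          proof (intro mult_left_mono prod_mono conjI D)
            fix i :: nat assume "i \<in> {..<5}"
            then have "k i < m" using k by (auto simp: grid_def)
            then show "(\<Sum>b<m. max 1 \<bar>real (k i) - real b\<bar> powr (- 9/10)) \<le> 22 * real m powr (1/10)"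
              by (rule sum_dist_powr_minus_nine_tenths_le)
          qed (auto intro: sum_nonneg)
          finally show ?thesis by simp
        qed
        have "(\<Sum>k\<in>grid m. \<Sum>l\<in>grid m. prob (E n k \<inter> E n l)) \<le> (\<Sum>k\<in>grid m. D * (22 * real m powr (1/10)) ^ 5)"
          by (intro sum_mono row)
        \<comment> \<open>One factor \<open>x\<close> comes from the row sums; the other arises from
          \<open>m ^ 5\<close> and the \<open>r ^ 9\<close> inside \<open>D\<close>.\<close>
        also have "\<dots> = real m ^ 5 * (D * (22 ^ 5 * x))"
          by (simp add: card_grid power_mult_distrib mid)
        also have "\<dots> = B * x\<^sup>2"
          by (simp add: D_def B_def x_def power_mult_distrib power2_eq_square mult_ac flip: power_mult)
        finally show ?thesis .
      qed
      have lt: "prob (E i k \<inter> E j l) \<le> prob (E i k) * prob (E j l)"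
        if "i < j" and k: "k \<in> grid m" and l: "l \<in> grid m" for i j k l
        unfolding E_def
      proof (rule prob_near_prog_disjoint_le)
        fix h :: nat assume "h < 4"
        then show "grid_time m i k h \<le> grid_time m i k (Suc h)" "grid_time m j l h \<le> grid_time m j l (Suc h)"
          using grid_time_bounds[OF k, of h i] grid_time_bounds[OF k, of "Suc h" i]
            grid_time_bounds[OF l, of h j] grid_time_bounds[OF l, of "Suc h" j] by simp_all
      next
        have "real i + 1 \<le> real j" using \<open>i < j\<close> by simp
        then show "grid_time m i k 4 \<le> grid_time m j l 0"
          using grid_time_bounds[OF k, of 4 i] grid_time_bounds[OF l, of 0 j] by simp
      qed (simp add: grid_time_def)
      show "prob (E i k \<inter> E j l) \<le> prob (E i k) * prob (E j l)"
        if "i \<noteq> j" and k: "k \<in> grid m" and l: "l \<in> grid m" for i j k l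
        using lt[of i j k l] lt[of j i l k] that by (cases "i < j") (auto simp: Int_commute mult.commute)
    qed (use N c x0 in auto)
    also have "(B * x\<^sup>2) / (real (card {..<N}) * (c * x)\<^sup>2) = B / c\<^sup>2 / real N"
      using x0 by (simp add: power_mult_distrib)
    finally show ?thesis by (simp add: E_def r_def)
  qed
  with B c show thesis by (intro that[of "B / c\<^sup>2"]) auto
qed

section \<open>Passage to the limit along the path\<close>

text \<open>Adding up increments that agree with the first up to \<open>r\<close>, the path point
  \<open>W (t j) \<omega>\<close> stays within \<open>j * r\<close> of the exact
  progression.\<close>

lemma infdist_near_prog_le:
  assumes \<omega>: "\<omega> \<in> near_prog r t" and t: "\<And>i. i < 5 \<Longrightarrow> W (t i) \<omega> \<in> C" and r: "0 \<le> r" and j: "j < 5"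
  shows "infdist (W (t 0) \<omega> + real j *\<^sub>R (W (t 1) \<omega> - W (t 0) \<omega>)) C \<le> 4 * r"
proof -
  let ?v = "W (t 1) \<omega> - W (t 0) \<omega>"
  have "norm (W (t j) \<omega> - (W (t 0) \<omega> + real j *\<^sub>R ?v)) \<le> real j * r" using j
  proof (induction j)
    case (Suc j)
    have "norm (W (t (Suc j)) \<omega> - W (t j) \<omega> - ?v) \<le> r"
    proof (cases "j = 0")
      case False
      with Suc have "j \<in> {1,2,3}" by auto
      with \<omega> have "W (t (Suc j)) \<omega> - W (t j) \<omega> \<in> cball ?v r"
        unfolding near_prog_def by blast
      then show ?thesis unfolding mem_cball dist_norm by (subst norm_minus_commute)
    qed (use r in simp)
    moreover have "W (t (Suc j)) \<omega> - (W (t 0) \<omega> + real (Suc j) *\<^sub>R ?v) =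
        (W (t j) \<omega> - (W (t 0) \<omega> + real j *\<^sub>R ?v)) + (W (t (Suc j)) \<omega> - W (t j) \<omega> - ?v)"
      by (simp add: scaleR_add_left)
    ultimately have "norm (W (t (Suc j)) \<omega> - (W (t 0) \<omega> + real (Suc j) *\<^sub>R ?v)) \<le>
        norm (W (t j) \<omega> - (W (t 0) \<omega> + real j *\<^sub>R ?v)) + r"
      by (simp only:) (rule order_trans[OF norm_triangle_ineq], rule add_left_mono)
    also have "\<dots> \<le> real j * r + r" using Suc by simp
    also have "\<dots> = real (Suc j) * r" by (simp add: distrib_right)
    finally show ?case .
  qed simp
  also have "\<dots> \<le> 4 * r" using j r by (intro mult_right_mono) auto
  finally show ?thesis
    using infdist_le2[OF t[OF j]] by (simp add: dist_norm norm_minus_commute)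
qed

text \<open>With \<open>N\<close> fixed, all grid times lie in \<open>{0..10 * real N}\<close>,
  whose image is compact, and arbitrarily fine meshes provide progressions with arbitrarily small
  error.\<close>

lemma contains_arith_prog_limsup:
  assumes cont: "continuous_on {0..} (\<lambda>t. W t \<omega>)"
    and \<omega>: "\<And>j. \<exists>m\<ge>j. \<exists>n<N. \<exists>k\<in>grid (Suc m). \<omega> \<in> near_prog (1 / sqrt (real (Suc m))) (grid_time (Suc m) n k)"
  shows "contains_arith_prog 5 (path_trace W \<omega>)"
proof -
  define C where "C = (\<lambda>t. W t \<omega>) ` {0..10 * real N}"
  have "contains_arith_prog 5 C"
  proof (rule contains_arith_prog_of_approx)
    show "compact C"
      unfolding C_def by (intro compact_continuous_image continuous_on_subset[OF cont]) auto
    fix \<epsilon> :: real assume \<epsilon>: "0 < \<epsilon>"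
    \<comment> \<open>Chosen so that the error \<open>4 / sqrt (Suc m)\<close> is at most
      \<open>\<epsilon>\<close> for all \<open>m \<ge> j\<close>.\<close>
    obtain j where j: "(4 / \<epsilon>)\<^sup>2 < real j" using reals_Archimedean2 by blast
    obtain m n k where mnk: "j \<le> m" "n < N" "k \<in> grid (Suc m)"
      "\<omega> \<in> near_prog (1 / sqrt (real (Suc m))) (grid_time (Suc m) n k)"
      using \<omega>[of j] by blast
    define t where "t = grid_time (Suc m) n k"
    have "4 / \<epsilon> \<le> sqrt (real (Suc m))"
      using j mnk(1) by (intro real_le_rsqrt) linarith
    then have r: "4 * (1 / sqrt (real (Suc m))) \<le> \<epsilon>"
      using \<epsilon> by (simp add: field_simps)
    have t: "W (t i) \<omega> \<in> C" if i: "i < 5" for i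
    proof -
      have "real n + 1 \<le> real N" using mnk(2) by simp
      moreover have "real i \<le> 4" using i by simp
      ultimately have "t i \<in> {0..10 * real N}"
        using grid_time_bounds[OF mnk(3) i, of n] unfolding t_def atLeastAtMost_iff by linarith
      then show ?thesis by (simp add: C_def)
    qed
    have "W (t 1) \<omega> - W (t 0) \<omega> \<in> cball (axis 1 2) 1"
      using mnk(4) by (simp add: near_prog_def t_def)
    \<comment> \<open>The ball has a centre of norm 2 and radius 1, so the step has length at least
      1.\<close>
    then have "1 \<le> dist (W (t 0) \<omega>) (W (t 1) \<omega>)"
      using norm_triangle_ineq2[of "axis 1 2 :: real^3" "axis 1 2 - (W (t 1) \<omega> - W (t 0) \<omega>)"]
      by (simp add: dist_norm norm_axis_2 norm_minus_commute)
    moreover have "infdist (W (t 0) \<omega> + real i *\<^sub>R (W (t 1) \<omega> - W (t 0) \<omega>)) C \<le> \<epsilon>" if "i < 5" for i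
      using infdist_near_prog_le[OF mnk(4)[folded t_def] t _ that] r by simp
    ultimately show "\<exists>a\<in>C. \<exists>b\<in>C. 1 \<le> dist a b \<and> (\<forall>j<5. infdist (a + real j *\<^sub>R (b - a)) C \<le> \<epsilon>)"
      using t[of 0] t[of 1] by auto
  qed simp
  moreover have "C \<subseteq> path_trace W \<omega>" by (auto simp: C_def path_trace_def)
  ultimately show ?thesis unfolding contains_arith_prog_def by blast
qed

lemma AE_contains_arith_prog_5: "AE \<omega> in M. contains_arith_prog 5 (path_trace W \<omega>)"
proof -
  obtain C where C: "0 < C" "\<And>m N. 0 < m \<Longrightarrow> 0 < N \<Longrightarrow>
    1 - C / real N \<le> prob (\<Union>n<N. \<Union>k\<in>grid m. near_prog (1 / sqrt (real m)) (grid_time m n k))"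
    using prob_Union_near_prog_grid_ge by blast
  \<comment> \<open>\<open>Suc m\<close> keeps the grid parameter positive, as the uniform bound
    requires.\<close>
  define F where "F = (\<lambda>N m. \<Union>n<N. \<Union>k\<in>grid (Suc m). near_prog (1 / sqrt (real (Suc m))) (grid_time (Suc m) n k))"
  \<comment> \<open>The limit superior of \<open>F N m\<close> in \<open>m\<close>: near
    progressions among the first \<open>N\<close> blocks occur for infinitely many meshes. As the
    bound for \<open>F N m\<close> is uniform in \<open>m\<close>, it passes to \<open>G N\<close>
    by continuity along the decreasing tails.\<close>
  define G where "G = (\<lambda>N. \<Inter>j. \<Union>m\<in>{j..}. F N m)"
  have F [measurable]: "F N m \<in> events" for N m
    unfolding F_def by (intro sets.finite_UN near_prog_sets) (auto simp: grid_time_def)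
  have G [measurable]: "G N \<in> events" for N
    unfolding G_def by measurable
  have PG: "1 - C / real N \<le> prob (G N)" if N: "0 < N" for N
  proof -
    have "(\<lambda>j. prob (\<Union>m\<in>{j..}. F N m)) \<longlonglongrightarrow> prob (G N)"
      unfolding G_def
    proof (rule finite_Lim_measure_decseq)
      show "decseq (\<lambda>j. \<Union>m\<in>{j..}. F N m)" by (force simp: decseq_def)
    qed auto
    moreover have "1 - C / real N \<le> prob (\<Union>m\<in>{j..}. F N m)" for j
    proof -
      have "1 - C / real N \<le> prob (F N j)" unfolding F_def by (rule C(2)[OF _ N]) simp
      also have "\<dots> \<le> prob (\<Union>m\<in>{j..}. F N m)" by (intro finite_measure_mono) auto
      finally show ?thesis .
    qed
    ultimately show ?thesis by (intro LIMSEQ_le_const) auto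
  qed
  have U: "(\<Union>N. G N) \<in> events" by measurable
  have "1 \<le> prob (\<Union>N. G N)"
  proof (rule LIMSEQ_le_const2)
    show "(\<lambda>N. 1 - C / real (Suc N)) \<longlonglongrightarrow> 1" using tendsto_diff[OF tendsto_const[of 1] LIMSEQ_Suc[OF lim_const_over_n[of C]]] by simp
    have "1 - C / real (Suc N) \<le> prob (\<Union>N. G N)" for N
      by (rule order_trans[OF PG]) (auto intro!: finite_measure_mono U)
    then show "\<exists>N. \<forall>n\<ge>N. 1 - C / real (Suc n) \<le> prob (\<Union>N. G N)" by blast
  qed
  then have "prob (\<Union>N. G N) = 1" using prob_le_1 by (intro antisym)
  then have "AE \<omega> in M. \<omega> \<in> (\<Union>N. G N)" by (rule AE_prob_1)
  with continuous_paths show ?thesis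
  proof eventually_elim
    case (elim \<omega>)
    then obtain N where "\<omega> \<in> G N" by blast
    then have "\<exists>m\<ge>j. \<exists>n<N. \<exists>k\<in>grid (Suc m). \<omega> \<in> near_prog (1 / sqrt (real (Suc m))) (grid_time (Suc m) n k)" for j
      unfolding G_def F_def by fastforce
    then show ?case by (rule contains_arith_prog_limsup[OF elim(1)])
  qed
qed

end

theorem lemma4:
  fixes M :: "'w measure" and W :: "real \<Rightarrow> 'w \<Rightarrow> real ^ 3"
  assumes "standard_brownian_motion M W"
  shows "AE \<omega> in M. contains_arith_prog 5 (path_trace W \<omega>)"
proof -
  interpret brownian_motion_3d M W
    using assms by (simp add: brownian_motion_3d_def)
  show ?thesis by (rule AE_contains_arith_prog_5)
qed

end
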